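(* For each sequence of real numbers $(a_n)_{n\geqslant1}$ converging to $0$ and each real number $p>2$, there exist a probability space $(\Omega,\mathcal F,\mu)$, a bijective, bi-measurable, measure-preserving map $T\colon\Omega\to\Omega$, a sub-$\sigma$-algebra $\mathcal M$ of $\mathcal F$ with $T\mathcal M\subset\mathcal M$, and an $\mathcal M$-measurable function $f\in\mathbb L^p(\Omega,\mathcal F,\mu)$ (so that $(f\circ T^j)_{j\geqslant0}$ is a strictly stationary sequence) such that $$\sum_{n=1}^{\infty}\frac{a_n}{n^{3/2}}\left\lVert\mathbb E[S_n(f)\mid\mathcal M]\right\rVert_p<\infty,$$ but the sequence of processes $\left(n^{-1/2}W(n,f,\cdot)\right)_{n\geqslant1}$ is not tight in $\mathcal H_{1/2-1/p}$.
   Context: Notation: $T\mathcal M=\{T(A):A\in\mathcal M\}$. For measurable $f\colon\Omega\to\mathbb R$, $S_n(f):=\sum_{j=0}^{n-1}f\circ T^j$ (with $S_0(f)=0$), and for $t\in[0,1]$, $$W(n,f,t):=S_{[nt]}(f)+(nt-[nt])\,f\circ T^{[nt]},$$ where $[\cdot]$ is the integer part. $\lVert\cdot\rVert_p$ is the norm of $\mathbb L^p(\Omega,\mathcal F,\mu)$. For $0<\alpha<1$, $\mathcal H_\alpha$ is the space of functions $x\colon[0,1]\to\mathbb R$ such that $\lVert x\rVert_{\mathcal H_\alpha}:=\sup_{0\leqslant s<t\leqslant1}\frac{|x(t)-x(s)|}{(t-s)^\alpha}+|x(0)|$ is finite, with this norm. The paths of $n^{-1/2}W(n,f,\cdot)$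 lie in the closed separable subspace $\mathcal H^o_\alpha=\{x\in\mathcal H_\alpha:\lim_{\delta\to0}\sup_{0<|t-s|<\delta}|x(t)-x(s)|/|t-s|^\alpha=0\}$ with $\alpha=1/2-1/p$. *)

theory Defs
  imports "HOL-Probability.Probability"
begin

definition invertible_measure_preserving :: "'w measure \<Rightarrow> ('w \<Rightarrow> 'w) \<Rightarrow> bool" where
  "invertible_measure_preserving M T \<longleftrightarrow>
     bij_betw T (space M) (space M) \<and>
     T \<in> measurable M M \<and>
     the_inv_into (space M) T \<in> measurable M M \<and>
     distr M M T = M"

definition strictly_stationary :: "'w measure \<Rightarrow> (nat \<Rightarrow> 'w \<Rightarrow> real) \<Rightarrow> bool" where
  "strictly_stationary M X \<longleftrightarrow>
     (\<forall>j. X j \<in> borel_measurable M) \<and>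
     (\<forall>k. distr M (\<Pi>\<^sub>M j\<in>UNIV. borel) (\<lambda>\<omega> j. X (j + k) \<omega>) =
          distr M (\<Pi>\<^sub>M j\<in>UNIV. borel) (\<lambda>\<omega> j. X j \<omega>))"

definition in_Lp :: "real \<Rightarrow> 'w measure \<Rightarrow> ('w \<Rightarrow> real) \<Rightarrow> bool" where
  "in_Lp p M f \<longleftrightarrow> f \<in> borel_measurable M \<and> integrable M (\<lambda>\<omega>. \<bar>f \<omega>\<bar> powr p)"

text \<open>Meaningful only for functions satisfying \<^const>\<open>in_Lp\<close>, since the Bochner integral of a
  non-integrable function is 0.\<close>

definition Lp_norm :: "real \<Rightarrow> 'w measure \<Rightarrow> ('w \<Rightarrow> real) \<Rightarrow> real" where
  "Lp_norm p M f = (\<integral>\<omega>. \<bar>f \<omega>\<bar> powr p \<partial>M) powr (1 / p)"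

definition ergodic_sum :: "('w \<Rightarrow> 'w) \<Rightarrow> ('w \<Rightarrow> real) \<Rightarrow> nat \<Rightarrow> 'w \<Rightarrow> real" where
  "ergodic_sum T f n \<omega> = (\<Sum>j<n. f ((T ^^ j) \<omega>))"

text \<open>Elements of the Hoelder space are functions on \<open>[0,1]\<close>, represented as functions on the
  reals that are \<open>undefined\<close> outside \<open>[0,1]\<close>; hence the restriction.\<close>

definition partial_sum_path ::
    "('w \<Rightarrow> 'w) \<Rightarrow> ('w \<Rightarrow> real) \<Rightarrow> nat \<Rightarrow> 'w \<Rightarrow> real \<Rightarrow> real" where
  "partial_sum_path T f n \<omega> = (\<lambda>t\<in>{0..1}.
     ergodic_sum T f (nat \<lfloor>real n * t\<rfloor>) \<omega> +
     (real n * t - of_int \<lfloor>real n * t\<rfloor>) * f ((T ^^ nat \<lfloor>real n * t\<rfloor>) \<omega>))"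

definition normalized_path ::
    "('w \<Rightarrow> 'w) \<Rightarrow> ('w \<Rightarrow> real) \<Rightarrow> nat \<Rightarrow> 'w \<Rightarrow> real \<Rightarrow> real" where
  "normalized_path T f n \<omega> = (\<lambda>t\<in>{0..1}. real n powr (- 1 / 2) * partial_sum_path T f n \<omega> t)"

definition holder_quotients :: "real \<Rightarrow> (real \<Rightarrow> real) \<Rightarrow> real set" where
  "holder_quotients \<alpha> x = {\<bar>x t - x s\<bar> / (t - s) powr \<alpha> | s t. 0 \<le> s \<and> s < t \<and> t \<le> 1}"

definition holder_space :: "real \<Rightarrow> (real \<Rightarrow> real) set" where
  "holder_space \<alpha> = {x \<in> extensional {0..1}. bdd_above (holder_quotients \<alpha> x)}"

definition holder_norm :: "real \<Rightarrow> (real \<Rightarrow> real) \<Rightarrow> real" where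
  "holder_norm \<alpha> x = Sup (holder_quotients \<alpha> x) + \<bar>x 0\<bar>"

text \<open>The case distinction only serves to make the distance nonnegative on the whole type,
  as the locale \<^locale>\<open>Metric_space\<close> demands.\<close>

definition holder_dist :: "real \<Rightarrow> (real \<Rightarrow> real) \<Rightarrow> (real \<Rightarrow> real) \<Rightarrow> real" where
  "holder_dist \<alpha> x y =
     (if x \<in> holder_space \<alpha> \<and> y \<in> holder_space \<alpha> then holder_norm \<alpha> (\<lambda>t. x t - y t) else 0)"

definition holder_topology :: "real \<Rightarrow> (real \<Rightarrow> real) topology" where
  "holder_topology \<alpha> = Metric_space.mtopology (holder_space \<alpha>) (holder_dist \<alpha>)"

text \<open>Tightness of the laws of the random elements \<open>Y n\<close>, \<open>n \<ge> 1\<close>, of the space \<open>X\<close>.\<close>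

definition tight_in :: "'b topology \<Rightarrow> 'w measure \<Rightarrow> (nat \<Rightarrow> 'w \<Rightarrow> 'b) \<Rightarrow> bool" where
  "tight_in X M Y \<longleftrightarrow>
     (\<forall>\<epsilon>>0. \<exists>K. compactin X K \<and> (\<forall>n\<ge>1. measure M {\<omega> \<in> space M. Y n \<omega> \<notin> K} \<le> \<epsilon>))"

lemma holder_quotients_nonempty: "holder_quotients \<alpha> x \<noteq> {}"
proof -
  have "\<bar>x 1 - x 0\<bar> / (1 - 0) powr \<alpha> \<in> holder_quotients \<alpha> x"
    unfolding holder_quotients_def by fastforce
  then show ?thesis by blast
qed

lemma holder_quotient_le_Sup:
  assumes "bdd_above (holder_quotients \<alpha> x)" "0 \<le> s" "s < t" "t \<le> 1"
  shows "\<bar>x t - x s\<bar> / (t - s) powr \<alpha> \<le> Sup (holder_quotients \<alpha> x)"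
  by (rule cSup_upper[OF _ assms(1)]) (use assms in \<open>auto simp: holder_quotients_def\<close>)

lemma holder_quotients_Sup_nonneg:
  assumes "bdd_above (holder_quotients \<alpha> x)"
  shows "0 \<le> Sup (holder_quotients \<alpha> x)"
  using holder_quotient_le_Sup[OF assms, of 0 1] by simp

lemma holder_quotients_triangle:
  assumes x: "bdd_above (holder_quotients \<alpha> x)" and y: "bdd_above (holder_quotients \<alpha> y)"
    and z: "\<And>s t. 0 \<le> s \<Longrightarrow> s < t \<Longrightarrow> t \<le> 1 \<Longrightarrow> \<bar>z t - z s\<bar> \<le> \<bar>x t - x s\<bar> + \<bar>y t - y s\<bar>"
  shows "bdd_above (holder_quotients \<alpha> z)"
    and "Sup (holder_quotients \<alpha> z) \<le> Sup (holder_quotients \<alpha> x) + Sup (holder_quotients \<alpha> y)"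
proof -
  have *: "q \<le> Sup (holder_quotients \<alpha> x) + Sup (holder_quotients \<alpha> y)"
    if q: "q \<in> holder_quotients \<alpha> z" for q
  proof -
    obtain s t where st: "0 \<le> s" "s < t" "t \<le> 1" "q = \<bar>z t - z s\<bar> / (t - s) powr \<alpha>"
      using q unfolding holder_quotients_def by blast
    have "q \<le> (\<bar>x t - x s\<bar> + \<bar>y t - y s\<bar>) / (t - s) powr \<alpha>"
      unfolding st(4) by (intro divide_right_mono z st) simp
    then show ?thesis
      using holder_quotient_le_Sup[OF x st(1-3)] holder_quotient_le_Sup[OF y st(1-3)]
      by (simp add: add_divide_distrib)
  qed
  show "bdd_above (holder_quotients \<alpha> z)" using * by (rule bdd_aboveI)
  show "Sup (holder_quotients \<alpha> z) \<le> Sup (holder_quotients \<alpha> x) + Sup (holder_quotients \<alpha> y)"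
    by (rule cSup_least[OF holder_quotients_nonempty *])
qed

lemma Metric_space_holder: "Metric_space (holder_space \<alpha>) (holder_dist \<alpha>)"
proof
  have bdd: "bdd_above (holder_quotients \<alpha> (\<lambda>t. x t - y t))"
    if "x \<in> holder_space \<alpha>" "y \<in> holder_space \<alpha>" for x y
    by (rule holder_quotients_triangle(1)[where x = x and y = y])
       (use that in \<open>auto simp: holder_space_def\<close>)
  have sym: "holder_quotients \<alpha> (\<lambda>t. x t - y t) = holder_quotients \<alpha> (\<lambda>t. y t - x t)" for x y
  proof -
    have "\<bar>(x t - y t) - (x s - y s)\<bar> = \<bar>(y t - x t) - (y s - x s)\<bar>" for s t by linarith
    then show ?thesis unfolding holder_quotients_def by simp
  qed
  fix x y
  show "0 \<le> holder_dist \<alpha> x y"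
    unfolding holder_dist_def holder_norm_def using holder_quotients_Sup_nonneg[OF bdd] by simp
  show "holder_dist \<alpha> x y = holder_dist \<alpha> y x"
    unfolding holder_dist_def holder_norm_def using sym[of x y] by (simp add: abs_minus_commute)
  show "holder_dist \<alpha> x y = 0 \<longleftrightarrow> x = y"
    if xy: "x \<in> holder_space \<alpha>" "y \<in> holder_space \<alpha>"
  proof
    let ?d = "\<lambda>t. x t - y t"
    assume "holder_dist \<alpha> x y = 0"
    then have 0: "Sup (holder_quotients \<alpha> ?d) = 0" "?d 0 = 0"
      using holder_quotients_Sup_nonneg[OF bdd[OF xy]] xy
      by (auto simp: holder_dist_def holder_norm_def)
    have "x t = y t" if t: "t \<in> {0..1}" for t
    proof (cases "t = 0")
      case False
      then have "0 < t" using t by auto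
      then have "\<bar>?d t - ?d 0\<bar> / (t - 0) powr \<alpha> \<le> 0"
        using holder_quotient_le_Sup[OF bdd[OF xy], of 0 t] t 0 by simp
      then show ?thesis using 0(2) \<open>0 < t\<close> by (simp add: divide_le_0_iff)
    qed (use 0 in auto)
    moreover have "x \<in> extensional {0..1}" "y \<in> extensional {0..1}"
      using xy by (auto simp: holder_space_def)
    ultimately show "x = y" by (auto intro: extensionalityI)
  next
    assume "x = y"
    moreover have "holder_quotients \<alpha> (\<lambda>t. 0) = {0}"
      using holder_quotients_nonempty[of \<alpha> "\<lambda>t. 0"] by (auto simp: holder_quotients_def)
    ultimately show "holder_dist \<alpha> x y = 0"
      by (simp add: holder_dist_def holder_norm_def)
  qed
  show "holder_dist \<alpha> x z \<le> holder_dist \<alpha> x y + holder_dist \<alpha> y z"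
    if "x \<in> holder_space \<alpha>" "y \<in> holder_space \<alpha>" "z \<in> holder_space \<alpha>" for z
  proof -
    have "Sup (holder_quotients \<alpha> (\<lambda>t. x t - z t))
        \<le> Sup (holder_quotients \<alpha> (\<lambda>t. x t - y t)) + Sup (holder_quotients \<alpha> (\<lambda>t. y t - z t))"
      by (rule holder_quotients_triangle(2)[OF bdd bdd]) (use that in auto)
    then show ?thesis using that by (simp add: holder_dist_def holder_norm_def)
  qed
qed

lemma partial_sum_path_Lipschitz:
  assumes "0 \<le> s" "s < t" "t \<le> 1"
  shows "\<bar>partial_sum_path T f n \<omega> t - partial_sum_path T f n \<omega> s\<bar>
           \<le> real n * (\<Sum>j\<le>n. \<bar>f ((T ^^ j) \<omega>)\<bar>) * (t - s)"
proof -
  define c where "c j u = max 0 (min 1 (u - real j))" for j u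
  have path: "partial_sum_path T f n \<omega> r = (\<Sum>j\<le>n. c j (real n * r) * f ((T ^^ j) \<omega>))"
    if r: "0 \<le> r" "r \<le> 1" for r
  proof -
    define m where "m = nat \<lfloor>real n * r\<rfloor>"
    have nr: "0 \<le> real n * r" "real n * r \<le> real n" using r by (auto simp: mult_left_le)
    then have fl: "of_int \<lfloor>real n * r\<rfloor> = real m" by (simp add: m_def)
    then have m: "real m \<le> real n * r" "real n * r < real m + 1" by linarith+
    then have "m \<le> n" using nr by linarith
    have "(\<Sum>j\<le>n. c j (real n * r) * f ((T ^^ j) \<omega>))
        = (\<Sum>j\<le>m. c j (real n * r) * f ((T ^^ j) \<omega>))"
      using \<open>m \<le> n\<close> m by (intro sum.mono_neutral_right) (auto simp: c_def)
    also have "\<dots> = (\<Sum>j<m. c j (real n * r) * f ((T ^^ j) \<omega>)) + c m (real n * r) * f ((T ^^ m) \<omega>)"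
      by (simp flip: lessThan_Suc_atMost)
    also have "(\<Sum>j<m. c j (real n * r) * f ((T ^^ j) \<omega>)) = (\<Sum>j<m. f ((T ^^ j) \<omega>))"
    proof (rule sum.cong[OF refl])
      fix j assume "j \<in> {..<m}"
      then have "real j + 1 \<le> real m" by auto
      then have "c j (real n * r) = 1" using m by (simp add: c_def)
      then show "c j (real n * r) * f ((T ^^ j) \<omega>) = f ((T ^^ j) \<omega>)" by simp
    qed
    also have "c m (real n * r) = real n * r - real m" using m by (simp add: c_def)
    finally show ?thesis
      using r fl by (simp add: partial_sum_path_def ergodic_sum_def flip: m_def)
  qed
  have "\<bar>c j (real n * t) - c j (real n * s)\<bar> \<le> real n * (t - s)" for j
  proof -
    have "real n * s \<le> real n * t" using assms by (simp add: mult_left_mono)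
    then show ?thesis unfolding c_def by (auto simp: algebra_simps)
  qed
  then have "\<bar>\<Sum>j\<le>n. (c j (real n * t) - c j (real n * s)) * f ((T ^^ j) \<omega>)\<bar>
      \<le> (\<Sum>j\<le>n. real n * (t - s) * \<bar>f ((T ^^ j) \<omega>)\<bar>)"
    by (intro order_trans[OF sum_abs] sum_mono) (simp add: abs_mult mult_right_mono)
  then show ?thesis
    using assms
    by (simp add: path left_diff_distrib sum_subtractf flip: sum_distrib_left)
       (simp add: mult.commute mult.left_commute)
qed

lemma normalized_path_in_holder_space:
  assumes "\<alpha> \<le> 1"
  shows "normalized_path T f n \<omega> \<in> holder_space \<alpha>"
proof -
  define C where "C = real n powr (- 1 / 2) * (real n * (\<Sum>j\<le>n. \<bar>f ((T ^^ j) \<omega>)\<bar>))"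
  have "0 \<le> C" by (auto simp: C_def intro!: mult_nonneg_nonneg sum_nonneg)
  have "\<bar>normalized_path T f n \<omega> t - normalized_path T f n \<omega> s\<bar> / (t - s) powr \<alpha> \<le> C"
    if st: "0 \<le> s" "s < t" "t \<le> 1" for s t
  proof -
    have "\<bar>normalized_path T f n \<omega> t - normalized_path T f n \<omega> s\<bar> =
        real n powr (- 1 / 2) * \<bar>partial_sum_path T f n \<omega> t - partial_sum_path T f n \<omega> s\<bar>"
      using st by (simp add: normalized_path_def abs_mult flip: right_diff_distrib)
    also have "\<dots> \<le> C * (t - s)"
      unfolding C_def mult.assoc[of "real n powr (- 1 / 2)"]
      by (intro mult_left_mono partial_sum_path_Lipschitz st) simp
    also have "t - s \<le> (t - s) powr \<alpha>"
      using powr_mono'[OF assms, of "t - s"] st by simp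
    finally show ?thesis using \<open>0 \<le> C\<close> st by (simp add: divide_le_eq mult_left_mono)
  qed
  then have "bdd_above (holder_quotients \<alpha> (normalized_path T f n \<omega>))"
    by (intro bdd_aboveI[of _ C]) (auto simp: holder_quotients_def)
  then show ?thesis by (simp add: holder_space_def normalized_path_def)
qed

end

(*
For a level (k, n) with k^(q+1) = n and q \<ge> p, let rare random signs, present at a site with
probability 1/n, be averaged over the last k sites and scaled by n^(1/p) k^(-1/2 - 1/p). The
resulting stationary process has p-norm of order k^(-1/2), its sums satisfy
||E[S_m | past]||_p \<le> C min(m, k) k^(-1/2), and within n steps it has, with probability bounded
below, an increment over k steps that is as large as the Hoelder exponent 1/2 - 1/p permits,
although k/n is small. The series of m^(-3/2) min(m, k) k^(-1/2) over m is bounded uniformly in k,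
and inserting the weights |a m| makes it tend to 0 as k grows, because each single term does. So one
superposes levels with k growing so fast that the weighted series stay summable. Large increments of
one level survive the superposition because flipping the sign of a single jump preserves the measure.
*)
theory Submission
  imports Defs
begin

section \<open>Tightness of polygonal paths in Hoelder spaces\<close>

text \<open>The scaling is forced. A jump of size A that is repeated over k sites and occurs with
  frequency 1/n has p-th moment of order A^p k / n, and within n steps it produces a Hoelder
  quotient n^(-1/2) A k / (k/n)^(1/2 - 1/p). Setting the quotient to 1 gives A = n^(1/p) k^(-1/2 -
  1/p), and the moment becomes k^(-p/2), in which n no longer occurs. So n can be taken large
  compared with k: two jumps in one block have probability of order (k/n)^2 and cost at most k^q,
  which is dominated by the first-order term k/n as soon as k^(q+1) \<le> n. The levels are not
  independent of each other, since a site carries only one of them. Sign flips, which preserve the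
  measure, take the place of independence twice. Flipping all positive sites identifies the
  conditional expectation of a partial sum as the average of the sum and its flip. Flipping a single
  site shows that a jump produces a large increment in at least half of the cases, without any
  estimate of the remaining jumps and levels.\<close>

lemma normalized_path_Lipschitz:
  assumes "0 \<le> s" "s < t" "t \<le> 1"
  shows "\<bar>normalized_path T f n \<omega> t - normalized_path T f n \<omega> s\<bar>
           \<le> real n powr (- 1 / 2) * real n * (\<Sum>j\<le>n. \<bar>f ((T ^^ j) \<omega>)\<bar>) * (t - s)"
proof -
  have "\<bar>normalized_path T f n \<omega> t - normalized_path T f n \<omega> s\<bar> =
      real n powr (- 1 / 2) * \<bar>partial_sum_path T f n \<omega> t - partial_sum_path T f n \<omega> s\<bar>"
    using assms by (simp add: normalized_path_def abs_mult flip: right_diff_distrib)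
  also have "\<dots> \<le> real n powr (- 1 / 2) * (real n * (\<Sum>j\<le>n. \<bar>f ((T ^^ j) \<omega>)\<bar>) * (t - s))"
    by (intro mult_left_mono partial_sum_path_Lipschitz assms) simp
  finally show ?thesis by (simp add: mult.assoc)
qed

lemma normalized_path_0 [simp]: "normalized_path T f n \<omega> 0 = 0"
  by (simp add: normalized_path_def partial_sum_path_def ergodic_sum_def)

text \<open>The path as a function of the value sequence alone: the system is the shift on
  sequences, observed at coordinate 0. This splits a random path into a measurable sequence of
  values and a deterministic map into the Hoelder space, which turns out to be continuous.\<close>

definition seq_path :: "nat \<Rightarrow> (nat \<Rightarrow> real) \<Rightarrow> real \<Rightarrow> real" where
  "seq_path n = normalized_path (\<lambda>v j. v (Suc j)) (\<lambda>v. v 0) n"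

lemma funpow_Suc_shift: "((\<lambda>v j. v (Suc j)) ^^ k) v = (\<lambda>j. v (j + k))"
  by (induction k arbitrary: v) (simp_all add: fun_eq_iff)

lemma normalized_path_eq_seq_path:
  "normalized_path T f n \<omega> = seq_path n (\<lambda>j. f ((T ^^ j) \<omega>))"
  by (simp add: seq_path_def normalized_path_def partial_sum_path_def ergodic_sum_def funpow_Suc_shift)

lemma seq_path_diff:
  assumes "t \<in> {0..1}"
  shows "seq_path n v t - seq_path n w t = seq_path n (\<lambda>j. v j - w j) t"
  using assms
  by (simp add: seq_path_def normalized_path_def partial_sum_path_def ergodic_sum_def
      funpow_Suc_shift sum_subtractf algebra_simps)

lemma holder_quotients_le_Lipschitz:
  fixes x :: "real \<Rightarrow> real"
  assumes "\<alpha> \<le> 1" "0 \<le> C" "0 \<le> s" "s < t" "t \<le> 1" "\<bar>x t - x s\<bar> \<le> C * (t - s)"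
  shows "\<bar>x t - x s\<bar> / (t - s) powr \<alpha> \<le> C * (t - s) powr (1 - \<alpha>)"
proof -
  have "\<bar>x t - x s\<bar> / (t - s) powr \<alpha> \<le> C * (t - s) / (t - s) powr \<alpha>"
    by (rule divide_right_mono[OF assms(6)]) simp
  then show ?thesis using assms by (simp add: powr_diff)
qed

text \<open>On [0,1] a Lipschitz constant dominates the Hoelder seminorm, since (t - s) powr (1 -
  \<alpha>) is at most 1. Only finitely many coordinates enter the bound, so the path depends
  continuously on the sequence in the product topology.\<close>

lemma holder_dist_seq_path_le:
  assumes "\<alpha> \<le> 1"
  shows "holder_dist \<alpha> (seq_path n v) (seq_path n w)
           \<le> real n powr (- 1 / 2) * real n * (\<Sum>j\<le>n. \<bar>v j - w j\<bar>)"
proof -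
  let ?C = "real n powr (- 1 / 2) * real n * (\<Sum>j\<le>n. \<bar>v j - w j\<bar>)"
  have C: "0 \<le> ?C" by (intro mult_nonneg_nonneg sum_nonneg) auto
  have "Sup (holder_quotients \<alpha> (\<lambda>t. seq_path n v t - seq_path n w t)) \<le> ?C"
  proof (rule cSup_least[OF holder_quotients_nonempty])
    fix q assume "q \<in> holder_quotients \<alpha> (\<lambda>t. seq_path n v t - seq_path n w t)"
    then obtain s t where st: "0 \<le> s" "s < t" "t \<le> 1"
      and q: "q = \<bar>seq_path n (\<lambda>j. v j - w j) t - seq_path n (\<lambda>j. v j - w j) s\<bar> / (t - s) powr \<alpha>"
      by (auto simp: holder_quotients_def seq_path_diff)
    have "q \<le> ?C * (t - s) powr (1 - \<alpha>)"
      unfolding q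
      using normalized_path_Lipschitz[OF st, of "\<lambda>v j. v (Suc j)" "\<lambda>v. v 0" n "\<lambda>j. v j - w j"]
      by (intro holder_quotients_le_Lipschitz assms C st)
        (simp add: funpow_Suc_shift seq_path_def)
    also have "\<dots> \<le> ?C * 1"
      using st assms by (intro mult_left_mono C powr_le1) auto
    finally show "q \<le> ?C" by simp
  qed
  moreover have "seq_path n v \<in> holder_space \<alpha>" "seq_path n w \<in> holder_space \<alpha>"
    by (simp_all add: seq_path_def normalized_path_in_holder_space assms)
  ultimately show ?thesis
    by (simp add: holder_dist_def holder_norm_def) (simp add: seq_path_def)
qed

lemma open_seq_path_vimage:
  assumes "\<alpha> \<le> 1" "openin (holder_topology \<alpha>) U"
  shows "open (seq_path n -` U)"
proof -
  interpret H: Metric_space "holder_space \<alpha>" "holder_dist \<alpha>" by (rule Metric_space_holder)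
  show ?thesis
  proof (subst open_subopen, intro ballI)
    fix v assume v: "v \<in> seq_path n -` U"
    obtain r where r: "r > 0" "H.mball (seq_path n v) r \<subseteq> U"
      using assms(2) v unfolding holder_topology_def H.openin_mtopology by auto
    let ?S = "{w. real n powr (- 1 / 2) * real n * (\<Sum>j\<le>n. \<bar>v j - w j\<bar>) < r}"
    have "open ?S"
      by (intro open_Collect_less continuous_intros continuous_on_product_coordinates)
    moreover have "v \<in> ?S" using r by simp
    moreover have "?S \<subseteq> seq_path n -` U"
    proof
      fix w assume "w \<in> ?S"
      then have "holder_dist \<alpha> (seq_path n v) (seq_path n w) < r"
        using holder_dist_seq_path_le[OF assms(1), of n v w] by simp
      then have "seq_path n w \<in> H.mball (seq_path n v) r"
        by (simp add: H.in_mball seq_path_def normalized_path_in_holder_space assms)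
      then show "w \<in> seq_path n -` U" using r by auto
    qed
    ultimately show "\<exists>S. open S \<and> v \<in> S \<and> S \<subseteq> seq_path n -` U" by blast
  qed
qed

text \<open>\<open>measure\<close> is 0 on nonmeasurable sets by default, so \<open>tight_in\<close>
  can be contradicted by monotonicity only if this event is measurable. It is, because compact sets
  of a metric space are closed and the path is a continuous function of its values.\<close>

lemma measurable_normalized_path_compact:
  assumes "\<alpha> \<le> 1" and K: "compactin (holder_topology \<alpha>) K"
    and [measurable]: "\<And>j. (\<lambda>\<omega>. f ((T ^^ j) \<omega>)) \<in> borel_measurable M"
  shows "{\<omega> \<in> space M. normalized_path T f n \<omega> \<notin> K} \<in> sets M"
proof -
  interpret H: Metric_space "holder_space \<alpha>" "holder_dist \<alpha>" by (rule Metric_space_holder)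
  have "closedin (holder_topology \<alpha>) K"
    using K compactin_imp_closedin H.Hausdorff_space_mtopology unfolding holder_topology_def by blast
  then have "openin (holder_topology \<alpha>) (holder_space \<alpha> - K)"
    by (metis H.topspace_mtopology holder_topology_def closedin_def)
  then have "open (seq_path n -` (holder_space \<alpha> - K))"
    by (rule open_seq_path_vimage[OF assms(1)])
  moreover have "(\<lambda>\<omega> j. f ((T ^^ j) \<omega>)) \<in> borel_measurable M"
    by (intro measurable_coordinatewise_then_product) simp
  ultimately have "(\<lambda>\<omega> j. f ((T ^^ j) \<omega>)) -` (seq_path n -` (holder_space \<alpha> - K)) \<inter> space M \<in> sets M"
    by (metis measurable_sets_borel borel_open measurable_sets)
  also have "(\<lambda>\<omega> j. f ((T ^^ j) \<omega>)) -` (seq_path n -` (holder_space \<alpha> - K)) \<inter> space M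
      = {\<omega> \<in> space M. normalized_path T f n \<omega> \<notin> K}"
    using normalized_path_in_holder_space[OF assms(1), of T f n]
    by (auto simp: normalized_path_eq_seq_path[symmetric])
  finally show ?thesis .
qed

text \<open>A sequence of Lipschitz paths in a totally bounded set has infinitely many members close to
  one of finitely many Lipschitz paths, whose Hoelder quotients vanish on short intervals.\<close>

lemma no_short_large_quotients_if_compact:
  assumes \<alpha>: "\<alpha> < 1" and K: "compactin (holder_topology \<alpha>) K" and \<delta>: "\<delta> \<longlonglongrightarrow> 0"
    and y: "\<And>i. y i \<in> K"
    and Lip: "\<And>i. \<exists>L. \<forall>s t. 0 \<le> s \<longrightarrow> s < t \<longrightarrow> t \<le> 1 \<longrightarrow> \<bar>y i t - y i s\<bar> \<le> L * (t - s)"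
    and large: "\<And>i. \<exists>s t. 0 \<le> s \<and> s < t \<and> t \<le> 1 \<and> t - s \<le> \<delta> i \<and>
                  1 \<le> \<bar>y i t - y i s\<bar> / (t - s) powr \<alpha>"
  shows False
proof -
  interpret H: Metric_space "holder_space \<alpha>" "holder_dist \<alpha>" by (rule Metric_space_holder)
  have "H.mtotally_bounded (range y)"
    using H.compactin_imp_mtotally_bounded K y H.mtotally_bounded_subset
    unfolding holder_topology_def by (metis image_subsetI)
  \<comment> \<open>The centres of a totally bounded set lie in the set itself, so each centre is
    some \<open>y j\<close> and inherits a Lipschitz bound.\<close>
  then obtain F where F: "finite F" "F \<subseteq> range y" "range y \<subseteq> (\<Union>x\<in>F. H.mball x (1/2))"
    unfolding H.mtotally_bounded_def by (meson half_gt_zero_iff zero_less_one)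
  have "\<exists>x\<in>F. \<exists>\<^sub>\<infinity>i. y i \<in> H.mball x (1/2)"
  proof (rule ccontr)
    assume "\<not> ?thesis"
    then have "finite (\<Union>x\<in>F. {i. y i \<in> H.mball x (1/2)})"
      using F(1) by (auto simp: frequently_cofinite)
    moreover have "(\<Union>x\<in>F. {i. y i \<in> H.mball x (1/2)}) = UNIV" using F(3) by blast
    ultimately show False by simp
  qed
  then obtain x where x: "x \<in> F" and inf: "\<exists>\<^sub>\<infinity>i. y i \<in> H.mball x (1/2)" by blast
  obtain L where L: "\<And>s t. 0 \<le> s \<Longrightarrow> s < t \<Longrightarrow> t \<le> 1 \<Longrightarrow> \<bar>x t - x s\<bar> \<le> L * (t - s)"
  proof -
    obtain j where "x = y j" using x F(2) by blast
    then show ?thesis using Lip[of j] that by auto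
  qed
  have L0: "0 \<le> L" using L[of 0 1] by simp
  have "((\<lambda>d. L * d powr (1 - \<alpha>)) \<longlongrightarrow> L * 0 powr (1 - \<alpha>)) (at_right 0)"
    using \<alpha> by (intro tendsto_intros) (auto simp: eventually_at_filter)
  then have "\<forall>\<^sub>F d in at_right 0. L * d powr (1 - \<alpha>) < 1/2"
    using \<alpha> by (intro order_tendstoD(2)) auto
  then obtain e where e: "e > 0" "\<And>d. 0 < d \<Longrightarrow> d < e \<Longrightarrow> L * d powr (1 - \<alpha>) < 1/2"
    by (auto simp: eventually_at_right_field)
  obtain i0 where i0: "\<And>i. i \<ge> i0 \<Longrightarrow> \<delta> i < e"
    using order_tendstoD(2)[OF \<delta> e(1)] by (auto simp: eventually_sequentially)
  obtain i where i: "i \<ge> i0" "y i \<in> H.mball x (1/2)"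
    using inf unfolding INFM_nat_le by blast
  obtain s t where st: "0 \<le> s" "s < t" "t \<le> 1" "t - s \<le> \<delta> i"
    and q: "1 \<le> \<bar>y i t - y i s\<bar> / (t - s) powr \<alpha>"
    using large by blast
  have mem: "x \<in> holder_space \<alpha>" "y i \<in> holder_space \<alpha>" "holder_dist \<alpha> x (y i) < 1/2"
    using i(2) by (auto simp: H.in_mball)
  have bdd: "bdd_above (holder_quotients \<alpha> (\<lambda>t. x t - y i t))"
  proof (rule holder_quotients_triangle(1))
    show "bdd_above (holder_quotients \<alpha> x)" "bdd_above (holder_quotients \<alpha> (y i))"
      using mem(1,2) by (simp_all add: holder_space_def)
  qed linarith
  have "Sup (holder_quotients \<alpha> (\<lambda>t. x t - y i t)) \<le> holder_dist \<alpha> x (y i)"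
    using mem(1,2) by (simp add: holder_dist_def holder_norm_def)
  with holder_quotient_le_Sup[OF bdd st(1-3)] mem(3)
  have 1: "\<bar>(x t - y i t) - (x s - y i s)\<bar> / (t - s) powr \<alpha> < 1/2" by linarith
  have "\<bar>x t - x s\<bar> / (t - s) powr \<alpha> \<le> L * (t - s) powr (1 - \<alpha>)"
    using \<alpha> L0 st(1-3) L[OF st(1-3)] by (intro holder_quotients_le_Lipschitz) simp_all
  also have "L * (t - s) powr (1 - \<alpha>) < 1/2"
  proof (rule e(2))
    show "0 < t - s" using st(2) by simp
    show "t - s < e" using st(4) i0[OF i(1)] by linarith
  qed
  finally have 2: "\<bar>x t - x s\<bar> / (t - s) powr \<alpha> < 1/2" .
  have "\<bar>y i t - y i s\<bar> / (t - s) powr \<alpha>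
      \<le> (\<bar>x t - x s\<bar> + \<bar>(x t - y i t) - (x s - y i s)\<bar>) / (t - s) powr \<alpha>"
    by (rule divide_right_mono) (linarith, simp)
  then have "1 \<le> \<bar>x t - x s\<bar> / (t - s) powr \<alpha> + \<bar>(x t - y i t) - (x s - y i s)\<bar> / (t - s) powr \<alpha>"
    using q by (simp only: add_divide_distrib)
  then show False using 1 2 by linarith
qed

text \<open>A compact set missed with probability at most \<epsilon>/2 must meet every event
  \<open>B i\<close>. Picking one outcome in each of them turns the question into one about a
  deterministic sequence of paths.\<close>

lemma (in prob_space) not_tight_if_short_large_quotients:
  assumes "\<alpha> < 1" "\<delta> \<longlonglongrightarrow> 0" "\<epsilon> > 0"
    and [measurable]: "\<And>j. (\<lambda>\<omega>. f ((T ^^ j) \<omega>)) \<in> borel_measurable M"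
    and n: "\<And>i. 1 \<le> n i"
    and B: "\<And>i. B i \<in> events" "\<And>i. \<epsilon> \<le> prob (B i)"
    and large: "\<And>i \<omega>. \<omega> \<in> B i \<Longrightarrow> \<exists>s t. 0 \<le> s \<and> s < t \<and> t \<le> 1 \<and> t - s \<le> \<delta> i \<and>
        1 \<le> \<bar>normalized_path T f (n i) \<omega> t - normalized_path T f (n i) \<omega> s\<bar> / (t - s) powr \<alpha>"
  shows "\<not> tight_in (holder_topology \<alpha>) M (normalized_path T f)"
proof
  assume "tight_in (holder_topology \<alpha>) M (normalized_path T f)"
  then obtain K where K: "compactin (holder_topology \<alpha>) K"
    and le: "\<And>n. n \<ge> 1 \<Longrightarrow> prob {\<omega> \<in> space M. normalized_path T f n \<omega> \<notin> K} \<le> \<epsilon> / 2"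
    unfolding tight_in_def using \<open>\<epsilon> > 0\<close> by (meson half_gt_zero)
  have "\<exists>\<omega>\<in>B i. normalized_path T f (n i) \<omega> \<in> K" for i
  proof (rule ccontr)
    assume "\<not> ?thesis"
    then have "B i \<subseteq> {\<omega> \<in> space M. normalized_path T f (n i) \<omega> \<notin> K}"
      using sets.sets_into_space[OF B(1)] by blast
    then have "prob (B i) \<le> prob {\<omega> \<in> space M. normalized_path T f (n i) \<omega> \<notin> K}"
      by (rule finite_measure_mono)
         (rule measurable_normalized_path_compact[OF _ K], use assms in auto)
    then show False using le[OF n, of i] B(2)[of i] \<open>\<epsilon> > 0\<close> by simp
  qed
  then obtain w where w: "\<And>i. w i \<in> B i" "\<And>i. normalized_path T f (n i) (w i) \<in> K" by metis
  show False
  proof (rule no_short_large_quotients_if_compact[OF assms(1) K assms(2)])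
    show "normalized_path T f (n i) (w i) \<in> K" for i by (rule w(2))
    show "\<exists>L. \<forall>s t. 0 \<le> s \<longrightarrow> s < t \<longrightarrow> t \<le> 1 \<longrightarrow>
        \<bar>normalized_path T f (n i) (w i) t - normalized_path T f (n i) (w i) s\<bar> \<le> L * (t - s)" for i
      by (intro exI allI impI) (rule normalized_path_Lipschitz)
    show "\<exists>s t. 0 \<le> s \<and> s < t \<and> t \<le> 1 \<and> t - s \<le> \<delta> i \<and>
        1 \<le> \<bar>normalized_path T f (n i) (w i) t - normalized_path T f (n i) (w i) s\<bar> / (t - s) powr \<alpha>" for i
      by (rule large[OF w(1)])
  qed
qed

section \<open>Countable sums in Lp\<close>

text \<open>The terms are dominated by \<open>Y powr (1/p)\<close> times the geometric weights 1/2,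
  1/4, ..., which add up to 1, so no constant is lost.\<close>

lemma infinite_sum_root_bound:
  fixes x :: "nat \<Rightarrow> real" and p Y :: real
  assumes "p > 0" "0 \<le> Y" and le: "\<And>i. (2 ^ Suc i * \<bar>x i\<bar>) powr p \<le> Y"
  shows "summable (\<lambda>i. \<bar>x i\<bar>)" "\<bar>\<Sum>i. x i\<bar> powr p \<le> Y"
proof -
  have x: "\<bar>x i\<bar> \<le> Y powr (1/p) * (1/2) ^ Suc i" for i
  proof -
    have "((2 ^ Suc i * \<bar>x i\<bar>) powr p) powr (1/p) \<le> Y powr (1/p)"
      using assms by (intro powr_mono2) auto
    then have "2 ^ Suc i * \<bar>x i\<bar> \<le> Y powr (1/p)" using assms by (simp add: powr_powr)
    then show ?thesis by (simp add: field_simps)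
  qed
  have s: "(\<lambda>i. Y powr (1/p) * (1/2) ^ Suc i) sums (Y powr (1/p) * 1)"
    by (intro sums_mult power_half_series)
  show sm: "summable (\<lambda>i. \<bar>x i\<bar>)"
    by (rule summable_comparison_test'[OF sums_summable[OF s]]) (use x in auto)
  have "\<bar>\<Sum>i. x i\<bar> \<le> (\<Sum>i. \<bar>x i\<bar>)" by (rule summable_rabs[OF sm])
  also have "\<dots> \<le> Y powr (1/p)"
    using suminf_le[OF x sm sums_summable[OF s]] sums_unique[OF s] by simp
  finally have "\<bar>\<Sum>i. x i\<bar> powr p \<le> (Y powr (1/p)) powr p" using assms by (intro powr_mono2) auto
  then show "\<bar>\<Sum>i. x i\<bar> powr p \<le> Y" using assms by (simp add: powr_powr)
qed

text \<open>The l^1 norm dominates the l^p norm: in z^p = z * z^(p-1) the second factor is at most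
  its value at the whole sum.\<close>

lemma suminf_powr_le:
  fixes z :: "nat \<Rightarrow> real"
  assumes "p \<ge> 1" "\<And>i. 0 \<le> z i" "summable z"
  shows "summable (\<lambda>i. z i powr p)" "(\<Sum>i. z i powr p) \<le> (\<Sum>i. z i) powr p"
proof -
  let ?Z = "\<Sum>i. z i"
  have Z: "0 \<le> ?Z" by (intro suminf_nonneg assms)
  have zZ: "z i \<le> ?Z" for i using sum_le_suminf[OF assms(3), of "{i}"] assms(2) by simp
  have le: "z i powr p \<le> z i * ?Z powr (p - 1)" for i
  proof (cases "z i = 0")
    case False
    then have "z i powr p = z i * z i powr (p - 1)"
      using assms(2)[of i] by (simp add: powr_diff)
    also have "\<dots> \<le> z i * ?Z powr (p - 1)"
      using assms zZ by (intro mult_left_mono powr_mono2) auto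
    finally show ?thesis .
  qed simp
  have s: "summable (\<lambda>i. z i * ?Z powr (p - 1))" by (intro summable_mult2 assms)
  show sm: "summable (\<lambda>i. z i powr p)"
    by (rule summable_comparison_test'[OF s]) (use le in auto)
  have "(\<Sum>i. z i powr p) \<le> (\<Sum>i. z i * ?Z powr (p - 1))" by (rule suminf_le[OF le sm s])
  also have "\<dots> = ?Z * ?Z powr (p - 1)" by (rule suminf_mult2[symmetric, OF assms(3)])
  also have "\<dots> = ?Z powr p" using Z by (cases "?Z = 0") (auto simp: powr_diff)
  finally show "(\<Sum>i. z i powr p) \<le> ?Z powr p" .
qed

text \<open>A crude countable Minkowski inequality: \<open>\<bar>\<Sum>i. x i\<bar> \<le> (SUP i. 2 ^ Suc i * \<bar>x i\<bar>)\<close>, and the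
  supremum is bounded by an \<open>\<ell>\<^sup>p\<close> norm.\<close>

lemma Lp_norm_suminf_le:
  fixes X :: "nat \<Rightarrow> 'w \<Rightarrow> real"
  assumes "p \<ge> 1" and Lp: "\<And>i. in_Lp p M (X i)" and y: "\<And>i. 0 \<le> y i"
    and le: "\<And>i. (\<integral>\<omega>. \<bar>X i \<omega>\<bar> powr p \<partial>M) \<le> y i powr p"
    and sm: "summable (\<lambda>i. 2 ^ Suc i * y i)"
  shows "AE \<omega> in M. summable (\<lambda>i. \<bar>X i \<omega>\<bar>)"
    and "in_Lp p M (\<lambda>\<omega>. \<Sum>i. X i \<omega>)"
    and "Lp_norm p M (\<lambda>\<omega>. \<Sum>i. X i \<omega>) \<le> (\<Sum>i. 2 ^ Suc i * y i)"
proof -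
  have [measurable]: "X i \<in> borel_measurable M" for i using Lp by (simp add: in_Lp_def)
  let ?z = "\<lambda>i. 2 ^ Suc i * y i"
  \<comment> \<open>A sum over i replaces the p-th power of the supremum. Its values are in
    \<open>ennreal\<close>, so it can be integrated term by term before any convergence is
    known.\<close>
  define S where "S \<omega> = (\<Sum>i. ennreal ((2 ^ Suc i * \<bar>X i \<omega>\<bar>) powr p))" for \<omega>
  have [measurable]: "S \<in> borel_measurable M" unfolding S_def by measurable
  have z: "0 \<le> ?z i" for i using y by simp
  note zp = suminf_powr_le[OF assms(1) z sm]
  have "(\<integral>\<^sup>+\<omega>. S \<omega> \<partial>M) = (\<Sum>i. \<integral>\<^sup>+\<omega>. ennreal ((2 ^ Suc i * \<bar>X i \<omega>\<bar>) powr p) \<partial>M)"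
    unfolding S_def by (rule nn_integral_suminf) simp
  also have "\<dots> \<le> (\<Sum>i. ennreal (?z i powr p))"
  proof (intro suminf_le allI)
    fix i
    have "(\<integral>\<^sup>+\<omega>. ennreal ((2 ^ Suc i * \<bar>X i \<omega>\<bar>) powr p) \<partial>M)
        = ennreal (\<integral>\<omega>. (2 ^ Suc i) powr p * \<bar>X i \<omega>\<bar> powr p \<partial>M)"
      using Lp[of i] by (subst nn_integral_eq_integral[symmetric])
        (auto simp: in_Lp_def powr_mult intro!: nn_integral_cong)
    also have "\<dots> \<le> ennreal ((2 ^ Suc i) powr p * y i powr p)"
      using le[of i] by (auto intro!: ennreal_leI mult_left_mono)
    also have "\<dots> = ennreal (?z i powr p)" by (simp add: powr_mult y)
    finally show "(\<integral>\<^sup>+\<omega>. ennreal ((2 ^ Suc i * \<bar>X i \<omega>\<bar>) powr p) \<partial>M) \<le> ennreal (?z i powr p)" .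
  qed auto
  also have "\<dots> = ennreal (\<Sum>i. ?z i powr p)"
    by (rule suminf_ennreal2[OF _ zp(1)]) simp
  also have "\<dots> \<le> ennreal ((\<Sum>i. ?z i) powr p)" by (intro ennreal_leI zp)
  finally have S_le: "(\<integral>\<^sup>+\<omega>. S \<omega> \<partial>M) \<le> ennreal ((\<Sum>i. ?z i) powr p)" .
  have "AE \<omega> in M. S \<omega> \<noteq> \<infinity>"
    by (rule nn_integral_PInf_AE) (use S_le in \<open>auto simp: top_unique\<close>)
  moreover have fin: "summable (\<lambda>i. \<bar>X i \<omega>\<bar>) \<and> ennreal (\<bar>\<Sum>i. X i \<omega>\<bar> powr p) \<le> S \<omega>"
    if finite: "S \<omega> \<noteq> \<infinity>" for \<omega>
  proof -
    obtain Y where Y: "0 \<le> Y" "S \<omega> = ennreal Y" using finite by (cases "S \<omega>" rule: ennreal_cases) (auto simp: infinity_ennreal_def)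
    have "ennreal ((2 ^ Suc i * \<bar>X i \<omega>\<bar>) powr p) \<le> ennreal Y" for i
    proof -
      have "(\<Sum>i\<in>{i}. ennreal ((2 ^ Suc i * \<bar>X i \<omega>\<bar>) powr p)) \<le> S \<omega>"
        unfolding S_def by (rule sum_le_suminf) (rule summableI, simp, simp)
      then show ?thesis by (simp only: Y(2) sum.insert_remove finite.emptyI empty_Diff sum.empty add_0_right)
    qed
    then have "(2 ^ Suc i * \<bar>X i \<omega>\<bar>) powr p \<le> Y" for i using Y(1) by (simp add: ennreal_le_iff)
    from infinite_sum_root_bound[OF _ Y(1) this] assms(1) show ?thesis
      unfolding Y(2) by (auto intro: ennreal_leI)
  qed
  ultimately have ae: "AE \<omega> in M. summable (\<lambda>i. \<bar>X i \<omega>\<bar>) \<and> ennreal (\<bar>\<Sum>i. X i \<omega>\<bar> powr p) \<le> S \<omega>"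
    by (auto elim: eventually_mono)
  show "AE \<omega> in M. summable (\<lambda>i. \<bar>X i \<omega>\<bar>)" using ae by (auto elim: eventually_mono)
  have "(\<integral>\<^sup>+\<omega>. ennreal (\<bar>\<Sum>i. X i \<omega>\<bar> powr p) \<partial>M) \<le> (\<integral>\<^sup>+\<omega>. S \<omega> \<partial>M)"
    using ae by (intro nn_integral_mono_AE) (auto elim: eventually_mono)
  also note S_le
  finally have n: "(\<integral>\<^sup>+\<omega>. ennreal (\<bar>\<Sum>i. X i \<omega>\<bar> powr p) \<partial>M) \<le> ennreal ((\<Sum>i. ?z i) powr p)" .
  have int: "integrable M (\<lambda>\<omega>. \<bar>\<Sum>i. X i \<omega>\<bar> powr p)"
    by (rule integrableI_nonneg) (use n in \<open>auto simp: top_unique intro: le_less_trans\<close>)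
  then show "in_Lp p M (\<lambda>\<omega>. \<Sum>i. X i \<omega>)" by (simp add: in_Lp_def)
  have "(\<integral>\<omega>. \<bar>\<Sum>i. X i \<omega>\<bar> powr p \<partial>M) \<le> (\<Sum>i. ?z i) powr p"
    using n by (subst (asm) nn_integral_eq_integral[OF int]) (auto simp: ennreal_le_iff)
  then have "Lp_norm p M (\<lambda>\<omega>. \<Sum>i. X i \<omega>) \<le> ((\<Sum>i. ?z i) powr p) powr (1/p)"
    unfolding Lp_norm_def using assms(1) by (intro powr_mono2) auto
  also have "\<dots> = (\<Sum>i. ?z i)"
    using assms(1) suminf_nonneg[OF sm z] by (simp add: powr_powr)
  finally show "Lp_norm p M (\<lambda>\<omega>. \<Sum>i. X i \<omega>) \<le> (\<Sum>i. ?z i)" .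
qed

lemma (in prob_space) in_Lp_imp_integrable:
  assumes "p \<ge> 1" "in_Lp p M f"
  shows "integrable M f"
proof (rule Bochner_Integration.integrable_bound)
  show "integrable M (\<lambda>\<omega>. 1 + \<bar>f \<omega>\<bar> powr p)" using assms by (simp add: in_Lp_def)
  have "\<bar>x\<bar> \<le> 1 + \<bar>x\<bar> powr p" for x :: real
  proof (cases "\<bar>x\<bar> \<le> 1")
    case False
    then show ?thesis using powr_mono[OF assms(1), of "\<bar>x\<bar>"] by simp
  qed (simp add: add_increasing2)
  then show "AE \<omega> in M. norm (f \<omega>) \<le> norm (1 + \<bar>f \<omega>\<bar> powr p)" by simp
qed (use assms in \<open>simp add: in_Lp_def\<close>)

section \<open>Two-sided sequences of rare signed jumps\<close>

text \<open>The symbol drawn at a site encodes an integer: level \<open>l\<close> with sign \<open>\<plusminus>1\<close> is the constant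
  sequence \<open>\<plusminus>(l + 1)\<close>, so that two levels never occur at the same site.\<close>

definition noise :: "(nat \<Rightarrow> real) pmf" where
  "noise = map_pmf (\<lambda>(l, s) _. (if s then 1 else - 1) * real (Suc l))
     (pair_pmf (geometric_pmf (1 / 2)) (bernoulli_pmf (1 / 2)))"

definition jump :: "nat \<Rightarrow> (nat \<Rightarrow> real) \<Rightarrow> real" where
  "jump l u = (if \<bar>u 0\<bar> = real (Suc l) then sgn (u 0) else 0)"

lemma jump_neg [simp]: "jump l (\<lambda>j. - u j) = - jump l u"
  by (simp add: jump_def sgn_minus)

lemma abs_jump: "\<bar>jump l u\<bar> = (if jump l u = 0 then 0 else 1)"
  by (auto simp: jump_def abs_sgn_eq)

lemma jump_eq_0_if_other: "jump l u \<noteq> 0 \<Longrightarrow> l' \<noteq> l \<Longrightarrow> jump l' u = 0"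
  by (auto simp: jump_def split: if_splits)

lemma map_pmf_Not_bernoulli_half: "map_pmf Not (bernoulli_pmf (1 / 2)) = bernoulli_pmf (1 / 2)"
proof (rule pmf_eqI)
  fix b
  have "Not -` {b} = {\<not> b}" by auto
  then show "pmf (map_pmf Not (bernoulli_pmf (1 / 2))) b = pmf (bernoulli_pmf (1 / 2)) b"
    by (cases b) (simp_all add: pmf_map measure_pmf_single)
qed

text \<open>The source of all sign arguments: this symmetry of a single site makes every
  \<open>flip\<close> measure preserving.\<close>

lemma map_pmf_neg_noise: "map_pmf (\<lambda>u j. - u j) noise = noise"
proof -
  have "map_pmf (\<lambda>u j. - u j) noise
      = map_pmf (\<lambda>(l, s) _. (if s then 1 else - 1) * real (Suc l))
          (map_pmf (map_prod id Not) (pair_pmf (geometric_pmf (1 / 2)) (bernoulli_pmf (1 / 2))))"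
    unfolding noise_def map_pmf_comp by (intro map_pmf_cong refl) (auto simp: fun_eq_iff)
  also have "map_pmf (map_prod id Not) (pair_pmf (geometric_pmf (1 / 2)) (bernoulli_pmf (1 / 2)))
      = pair_pmf (map_pmf id (geometric_pmf (1 / 2))) (map_pmf Not (bernoulli_pmf (1 / 2)))"
    unfolding map_prod_def by (rule map_pair)
  finally show ?thesis by (simp add: map_pmf_Not_bernoulli_half noise_def)
qed

text \<open>The geometric law gives level l the frequency 1 / 2 ^ Suc l, so \<open>2 ^ Suc l\<close>
  is the natural number of steps in which to observe that level.\<close>

lemma prob_jump_nonzero: "measure_pmf.prob noise {u. jump l u \<noteq> 0} = 1 / 2 ^ Suc l"
proof -
  have "measure_pmf.prob noise {u. jump l u \<noteq> 0}
      = measure_pmf.prob (pair_pmf (geometric_pmf (1 / 2)) (bernoulli_pmf (1 / 2))) (fst -` {l})"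
    unfolding noise_def measure_map_pmf
    by (intro arg_cong2[where f = measure_pmf.prob] refl) (auto simp: jump_def abs_mult split: if_splits)
  also have "\<dots> = measure_pmf.prob (map_pmf fst
      (pair_pmf (geometric_pmf (1 / 2)) (bernoulli_pmf (1 / 2)))) {l}"
    by (simp only: measure_map_pmf)
  also have "\<dots> = 1 / 2 ^ Suc l"
    by (simp add: map_fst_pair_pmf measure_pmf_single power_divide)
  finally show ?thesis .
qed

definition noise_space :: "(int \<Rightarrow> nat \<Rightarrow> real) measure" where
  "noise_space = PiM UNIV (\<lambda>_. measure_pmf noise)"

lemma space_noise_space [simp]: "space noise_space = UNIV"
  by (simp add: noise_space_def space_PiM PiE_UNIV_domain)

interpretation noise: prob_space noise_space
  unfolding noise_space_def by (rule prob_space_PiM) (rule prob_space_measure_pmf)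

lemma measurable_site [measurable]: "(\<lambda>\<omega>. h (\<omega> r)) \<in> measurable noise_space borel"
proof -
  have "(\<lambda>\<omega>. \<omega> r) \<in> measurable noise_space (measure_pmf noise)"
    unfolding noise_space_def by (rule measurable_component_singleton) simp
  then show ?thesis by (rule measurable_compose) simp
qed

lemma prod_emb_UNIV: "prod_emb UNIV (\<lambda>_. measure_pmf noise) J (Pi\<^sub>E J A) = {\<omega>. \<forall>r\<in>J. \<omega> r \<in> A r}"
  by (auto simp: prod_emb_def)

lemma prob_cylinder:
  assumes "finite J"
  shows "noise.prob {\<omega>. \<forall>r\<in>J. \<omega> r \<in> A r} = (\<Prod>r\<in>J. measure_pmf.prob noise (A r))"
proof -
  interpret product_prob_space "\<lambda>_::int. measure_pmf noise" UNIV
    by (simp add: product_prob_spaceI prob_space_measure_pmf)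
  show ?thesis using measure_PiM_emb[of J A] assms
    by (simp add: prod_emb_UNIV noise_space_def)
qed

lemma emeasure_cylinder:
  assumes "finite J"
  shows "emeasure noise_space {\<omega>. \<forall>r\<in>J. \<omega> r \<in> A r} = (\<Prod>r\<in>J. emeasure (measure_pmf noise) (A r))"
  using emeasure_PiM_emb[of UNIV "\<lambda>_. measure_pmf noise" J A] assms
  by (simp add: prod_emb_UNIV noise_space_def prob_space_measure_pmf)

section \<open>Sign flips, the shift and the past\<close>

lemma distr_noise_space_eqI:
  assumes m: "F \<in> measurable noise_space noise_space"
    and "\<And>J A. finite J \<Longrightarrow>
      emeasure noise_space {\<omega>. \<forall>r\<in>J. F \<omega> r \<in> A r} = (\<Prod>r\<in>J. emeasure (measure_pmf noise) (A r))"
  shows "distr noise_space noise_space F = noise_space"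
proof -
  have "noise_space = distr noise_space noise_space F"
  proof (rule measure_eqI_PiM_infinite[where I = UNIV and M = "\<lambda>_. measure_pmf noise"])
    fix J A assume J: "finite (J::int set)"
    have cyl: "{\<omega>. \<forall>r\<in>J. \<omega> r \<in> A r} \<in> sets noise_space"
      unfolding noise_space_def prod_emb_UNIV[symmetric]
      by (rule sets_PiM_I) (use J in auto)
    show "emeasure noise_space (prod_emb UNIV (\<lambda>_. measure_pmf noise) J (Pi\<^sub>E J A))
        = emeasure (distr noise_space noise_space F) (prod_emb UNIV (\<lambda>_. measure_pmf noise) J (Pi\<^sub>E J A))"
      unfolding prod_emb_UNIV emeasure_distr[OF m cyl]
      using assms(2)[OF J, of A] emeasure_cylinder[OF J, of A] by (simp add: vimage_def)
  qed (simp_all add: noise_space_def, simp add: noise.finite_measure_axioms flip: noise_space_def)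
  then show ?thesis by simp
qed

definition flip :: "int set \<Rightarrow> (int \<Rightarrow> nat \<Rightarrow> real) \<Rightarrow> int \<Rightarrow> nat \<Rightarrow> real" where
  "flip R \<omega> = (\<lambda>r. if r \<in> R then (\<lambda>j. - \<omega> r j) else \<omega> r)"

lemma jump_flip: "jump l (flip R \<omega> r) = (if r \<in> R then - jump l (\<omega> r) else jump l (\<omega> r))"
  by (simp add: flip_def)

text \<open>All subsets of the symbol space of a \<open>pmf\<close> are measurable, so h may be
  arbitrary. This covers the flips and the shifts in both directions.\<close>

lemma measurable_into_noise_space:
  assumes "\<And>r. \<exists>h s. \<forall>\<omega>. F \<omega> r = h (\<omega> s)"
  shows "F \<in> measurable noise_space noise_space"
proof -
  have "(\<lambda>\<omega>. F \<omega> r) \<in> measurable noise_space (measure_pmf noise)" for r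
  proof -
    obtain h s where h: "\<And>\<omega>. F \<omega> r = h (\<omega> s)" using assms by meson
    have "(\<lambda>\<omega>. \<omega> s) \<in> measurable noise_space (measure_pmf noise)"
      unfolding noise_space_def by (rule measurable_component_singleton) simp
    then have "(\<lambda>\<omega>. h (\<omega> s)) \<in> measurable noise_space (measure_pmf noise)"
      by (rule measurable_compose) simp
    then show ?thesis by (simp add: h)
  qed
  then have "(\<lambda>\<omega>. \<lambda>r\<in>UNIV. F \<omega> r) \<in> measurable noise_space (PiM UNIV (\<lambda>_. measure_pmf noise))"
    by (rule measurable_restrict)
  then show ?thesis by (simp add: restrict_UNIV flip: noise_space_def)
qed

lemma measurable_flip [measurable]: "flip R \<in> measurable noise_space noise_space"
proof (rule measurable_into_noise_space)
  fix r show "\<exists>h s. \<forall>\<omega>. flip R \<omega> r = h (\<omega> s)"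
    by (rule exI[of _ "\<lambda>u. if r \<in> R then (\<lambda>j. - u j) else u"], rule exI[of _ r]) (simp add: flip_def)
qed

lemma distr_flip: "distr noise_space noise_space (flip R) = noise_space"
proof (rule distr_noise_space_eqI[OF measurable_flip])
  fix J :: "int set" and A :: "int \<Rightarrow> (nat \<Rightarrow> real) set" assume J: "finite J"
  let ?A = "\<lambda>r. if r \<in> R then (\<lambda>u j. - u j) -` A r else A r"
  have "{\<omega>. \<forall>r\<in>J. flip R \<omega> r \<in> A r} = {\<omega>. \<forall>r\<in>J. \<omega> r \<in> ?A r}" by (auto simp: flip_def)
  moreover have "emeasure (measure_pmf noise) (?A r) = emeasure (measure_pmf noise) (A r)" for r
    using emeasure_map_pmf[of "\<lambda>u j. - u j" noise "A r"] by (simp add: map_pmf_neg_noise)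
  ultimately show "emeasure noise_space {\<omega>. \<forall>r\<in>J. flip R \<omega> r \<in> A r}
      = (\<Prod>r\<in>J. emeasure (measure_pmf noise) (A r))"
    by (simp add: emeasure_cylinder[OF J])
qed

definition left_shift :: "(int \<Rightarrow> nat \<Rightarrow> real) \<Rightarrow> int \<Rightarrow> nat \<Rightarrow> real" where
  "left_shift \<omega> = (\<lambda>r. \<omega> (r + 1))"

lemma shift_funpow: "(left_shift ^^ j) \<omega> r = \<omega> (r + int j)"
  by (induction j arbitrary: \<omega>) (simp_all add: left_shift_def funpow_swap1 algebra_simps)

lemma bij_shift: "bij left_shift"
  by (rule o_bij[of "\<lambda>\<omega> r. \<omega> (r - 1)"]) (auto simp: left_shift_def fun_eq_iff)

lemma inv_shift: "the_inv_into UNIV left_shift = (\<lambda>\<omega> r. \<omega> (r - 1))"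
proof
  fix \<omega>
  have "left_shift (\<lambda>r. \<omega> (r - 1)) = \<omega>" by (simp add: left_shift_def)
  then show "the_inv_into UNIV left_shift \<omega> = (\<lambda>r. \<omega> (r - 1))"
    by (metis bij_shift bij_is_inj the_inv_into_f_f UNIV_I)
qed

lemma measurable_shift [measurable]: "left_shift \<in> measurable noise_space noise_space"
  by (rule measurable_into_noise_space) (auto simp: left_shift_def)

lemma distr_shift: "distr noise_space noise_space left_shift = noise_space"
proof (rule distr_noise_space_eqI[OF measurable_shift])
  fix J :: "int set" and A :: "int \<Rightarrow> (nat \<Rightarrow> real) set" assume J: "finite J"
  have "{\<omega>. \<forall>r\<in>J. left_shift \<omega> r \<in> A r} = {\<omega>. \<forall>r\<in>(\<lambda>r. r + 1) ` J. \<omega> r \<in> A (r - 1)}"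
    by (auto simp: left_shift_def)
  then have "emeasure noise_space {\<omega>. \<forall>r\<in>J. left_shift \<omega> r \<in> A r}
      = (\<Prod>r\<in>(\<lambda>r. r + 1) ` J. emeasure (measure_pmf noise) (A (r - 1)))"
    using emeasure_cylinder[of "(\<lambda>r. r + 1) ` J" "\<lambda>r. A (r - 1)"] J by (simp only: finite_imageI)
  then show "emeasure noise_space {\<omega>. \<forall>r\<in>J. left_shift \<omega> r \<in> A r}
      = (\<Prod>r\<in>J. emeasure (measure_pmf noise) (A r))"
    by (simp add: prod.reindex)
qed

lemma invertible_shift: "invertible_measure_preserving noise_space left_shift"
proof -
  have "(\<lambda>\<omega> r. \<omega> (r - 1)) \<in> measurable noise_space noise_space"
    by (rule measurable_into_noise_space) auto
  then show ?thesis
    by (simp add: invertible_measure_preserving_def bij_shift inv_shift distr_shift measurable_shift)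
qed

text \<open>The events decided by the sites r \<le> 0, given as an explicit family instead of by
  generators: that such an event ignores every change at positive sites can then be read off. The
  zero measure is a placeholder, since \<open>subalgebra\<close> compares only spaces and
  sets.\<close>

definition past :: "(int \<Rightarrow> nat \<Rightarrow> real) measure" where
  "past = measure_of UNIV
     {A \<in> sets noise_space. \<forall>\<omega> \<omega>'. (\<forall>r\<le>0. \<omega> r = \<omega>' r) \<longrightarrow> \<omega> \<in> A \<longrightarrow> \<omega>' \<in> A} (\<lambda>_. 0)"

lemma space_past [simp]: "space past = UNIV"
  by (simp add: past_def)

lemma sets_past:
  "sets past = {A \<in> sets noise_space. \<forall>\<omega> \<omega>'. (\<forall>r\<le>0. \<omega> r = \<omega>' r) \<longrightarrow> \<omega> \<in> A \<longrightarrow> \<omega>' \<in> A}"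
    (is "_ = ?S")
proof -
  have "sigma_algebra UNIV ?S"
    unfolding sigma_algebra_iff2
  proof (intro conjI ballI allI impI)
    fix A assume A: "A \<in> ?S"
    have "UNIV - A \<in> sets noise_space" using sets.compl_sets[of A noise_space] A by simp
    moreover have "\<omega>' \<in> UNIV - A" if "\<forall>r\<le>0. \<omega> r = \<omega>' r" "\<omega> \<in> UNIV - A" for \<omega> \<omega>'
    proof
      have "\<forall>r\<le>0. \<omega>' r = \<omega> r" using that(1) by simp
      then show "\<omega>' \<notin> A" using A that(2) by blast
    qed simp
    ultimately show "UNIV - A \<in> ?S" by blast
  next
    fix A :: "nat \<Rightarrow> (int \<Rightarrow> nat \<Rightarrow> real) set" assume A: "range A \<subseteq> ?S"
    then have "\<Union> (range A) \<in> sets noise_space" by (intro sets.countable_UN) auto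
    then show "\<Union> (range A) \<in> ?S" using A by blast
  qed auto
  then show ?thesis by (simp add: past_def sigma_algebra.sigma_sets_eq)
qed

lemma subalgebra_past: "subalgebra noise_space past"
  by (auto simp: subalgebra_def sets_past)

text \<open>The image under the shift is the preimage under its inverse, which reads one site
  further to the left. The image is therefore decided by the sites r \<le> -1.\<close>

lemma shift_past:
  assumes "A \<in> sets past"
  shows "left_shift ` A \<in> sets past"
proof -
  have eq: "left_shift ` A = {\<omega>. (\<lambda>r. \<omega> (r - 1)) \<in> A}"
  proof (intro set_eqI iffI)
    fix \<omega> assume "\<omega> \<in> left_shift ` A"
    then obtain a where "a \<in> A" "\<omega> = left_shift a" by blast
    then show "\<omega> \<in> {\<omega>. (\<lambda>r. \<omega> (r - 1)) \<in> A}" by (simp add: left_shift_def)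
  next
    fix \<omega> assume "\<omega> \<in> {\<omega>. (\<lambda>r. \<omega> (r - 1)) \<in> A}"
    moreover have "\<omega> = left_shift (\<lambda>r. \<omega> (r - 1))" by (simp add: left_shift_def)
    ultimately show "\<omega> \<in> left_shift ` A" by blast
  qed
  have "(\<lambda>\<omega> r. \<omega> (r - 1)) \<in> measurable noise_space noise_space"
    by (rule measurable_into_noise_space) auto
  from measurable_sets[OF this, of A] have "left_shift ` A \<in> sets noise_space"
    using assms by (simp add: eq sets_past vimage_def)
  moreover have "\<omega>' \<in> left_shift ` A" if "\<forall>r\<le>0. \<omega> r = \<omega>' r" "\<omega> \<in> left_shift ` A" for \<omega> \<omega>'
  proof -
    let ?b = "\<lambda>(\<omega> :: int \<Rightarrow> nat \<Rightarrow> real) r. \<omega> (r - 1)"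
    have 1: "\<forall>r\<le>0. ?b \<omega> r = ?b \<omega>' r" using that(1) by simp
    have 2: "?b \<omega> \<in> A" using that(2) eq by blast
    have "\<And>\<omega> \<omega>'. (\<forall>r\<le>0. \<omega> r = \<omega>' r) \<Longrightarrow> \<omega> \<in> A \<Longrightarrow> \<omega>' \<in> A"
      using assms unfolding sets_past by blast
    from this[OF 1 2] show ?thesis unfolding eq by simp
  qed
  ultimately show ?thesis by (auto simp: sets_past)
qed

lemma measurable_pastI:
  fixes g :: "(int \<Rightarrow> nat \<Rightarrow> real) \<Rightarrow> real"
  assumes g: "g \<in> borel_measurable noise_space"
    and past: "\<And>\<omega> \<omega>'. (\<And>r. r \<le> 0 \<Longrightarrow> \<omega> r = \<omega>' r) \<Longrightarrow> g \<omega> = g \<omega>'"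
  shows "g \<in> borel_measurable past"
proof (rule measurableI)
  fix B :: "real set" assume "B \<in> sets borel"
  then have "g -` B \<in> sets noise_space" using measurable_sets[OF g] by simp
  moreover have "\<omega>' \<in> g -` B" if "\<forall>r\<le>0. \<omega> r = \<omega>' r" "\<omega> \<in> g -` B" for \<omega> \<omega>'
    using past[of \<omega> \<omega>'] that by auto
  ultimately show "g -` B \<inter> space past \<in> sets past" by (auto simp: sets_past)
qed simp

lemma flip_future_past:
  assumes "A \<in> sets past"
  shows "flip {1..} \<omega> \<in> A \<longleftrightarrow> \<omega> \<in> A"
proof -
  have "\<forall>r\<le>0. flip {1..} \<omega> r = \<omega> r" "\<forall>r\<le>0. \<omega> r = flip {1..} \<omega> r" by (auto simp: flip_def)
  then show ?thesis using assms unfolding sets_past by blast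
qed

section \<open>Moments of the number of jumps in a block\<close>

lemma expectation_jump: "noise.expectation (\<lambda>\<omega>. \<bar>jump l (\<omega> r)\<bar>) = 1 / 2 ^ Suc l"
proof -
  have "noise.expectation (\<lambda>\<omega>. \<bar>jump l (\<omega> r)\<bar>)
      = noise.expectation (indicator {\<omega>. \<forall>s\<in>{r}. \<omega> s \<in> {u. jump l u \<noteq> 0}})"
    by (intro Bochner_Integration.integral_cong refl) (auto simp: abs_jump indicator_def)
  also have "\<dots> = 1 / 2 ^ Suc l"
    using prob_cylinder[of "{r}" "\<lambda>_. {u. jump l u \<noteq> 0}"] by (simp add: prob_jump_nonzero)
  finally show ?thesis .
qed

lemma expectation_jump_pair:
  assumes "r \<noteq> s"
  shows "noise.expectation (\<lambda>\<omega>. \<bar>jump l (\<omega> r)\<bar> * \<bar>jump l (\<omega> s)\<bar>) = (1 / 2 ^ Suc l)\<^sup>2"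
proof -
  have "noise.expectation (\<lambda>\<omega>. \<bar>jump l (\<omega> r)\<bar> * \<bar>jump l (\<omega> s)\<bar>)
      = noise.expectation (indicator {\<omega>. \<forall>t\<in>{r, s}. \<omega> t \<in> {u. jump l u \<noteq> 0}})"
    by (intro Bochner_Integration.integral_cong refl) (auto simp: abs_jump indicator_def)
  also have "\<dots> = (1 / 2 ^ Suc l)\<^sup>2"
    using prob_cylinder[of "{r, s}" "\<lambda>_. {u. jump l u \<noteq> 0}"] assms
    by (simp add: prob_jump_nonzero power2_eq_square)
  finally show ?thesis .
qed

text \<open>If at most one x s is 1, the sum is 0 or 1 and equals its own power. Otherwise some pair
  contributes 1 to the double sum, and k^q bounds the largest possible value k^p.\<close>

lemma sum_01_powr_le:
  fixes x :: "nat \<Rightarrow> real"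
  assumes x: "\<And>s. x s = 0 \<or> x s = 1" and p: "0 < p" "p \<le> real q"
  shows "(\<Sum>s<k. x s) powr p \<le> (\<Sum>s<k. x s) + real k ^ q * (\<Sum>s<k. \<Sum>t\<in>{..<k} - {s}. x s * x t)"
proof -
  have x0: "0 \<le> x s" and x1: "x s \<le> 1" for s using x[of s] by auto
  have S0: "0 \<le> (\<Sum>s<k. x s)" by (intro sum_nonneg x0)
  have D0: "0 \<le> (\<Sum>t\<in>{..<k} - {s}. x s * x t)" for s by (intro sum_nonneg mult_nonneg_nonneg x0)
  show ?thesis
  proof (cases "\<exists>s<k. \<exists>t<k. s \<noteq> t \<and> x s = 1 \<and> x t = 1")
    case True
    then obtain s t where st: "s < k" "t < k" "s \<noteq> t" "x s = 1" "x t = 1" by blast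
    have "1 = x s * x t" using st by simp
    also have "\<dots> \<le> (\<Sum>t\<in>{..<k} - {s}. x s * x t)"
      using st by (intro member_le_sum) (auto intro!: mult_nonneg_nonneg x0)
    also have "\<dots> \<le> (\<Sum>s<k. \<Sum>t\<in>{..<k} - {s}. x s * x t)"
      using st by (intro member_le_sum D0) auto
    finally have D: "1 \<le> (\<Sum>s<k. \<Sum>t\<in>{..<k} - {s}. x s * x t)" .
    have "(\<Sum>s<k. x s) \<le> real k" using sum_bounded_above[of "{..<k}" x 1] x1 by simp
    then have "(\<Sum>s<k. x s) powr p \<le> real k powr p" using S0 p by (intro powr_mono2) auto
    also have "\<dots> \<le> real k powr real q" using p st by (intro powr_mono) auto
    also have "\<dots> = real k ^ q * 1" using st by (simp add: powr_realpow)
    also have "\<dots> \<le> real k ^ q * (\<Sum>s<k. \<Sum>t\<in>{..<k} - {s}. x s * x t)"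
      by (intro mult_left_mono D) simp
    finally show ?thesis using S0 by linarith
  next
    case False
    have "(\<Sum>s<k. x s) = 0 \<or> (\<Sum>s<k. x s) = 1"
    proof (cases "\<exists>s<k. x s = 1")
      case True
      then obtain s where s: "s < k" "x s = 1" by blast
      have "(\<Sum>s<k. x s) = x s + (\<Sum>t\<in>{..<k} - {s}. x t)" using s by (subst sum.remove[of _ s]) auto
      also have "(\<Sum>t\<in>{..<k} - {s}. x t) = 0"
        using False s x by (intro sum.neutral) (metis DiffE lessThan_iff singletonI)
      finally show ?thesis using s by simp
    next
      case False
      then have "(\<Sum>s<k. x s) = 0" using x by (intro sum.neutral) auto
      then show ?thesis by simp
    qed
    then have "(\<Sum>s<k. x s) powr p = (\<Sum>s<k. x s)" using p by auto
    moreover have "0 \<le> real k ^ q * (\<Sum>s<k. \<Sum>t\<in>{..<k} - {s}. x s * x t)"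
      by (intro mult_nonneg_nonneg sum_nonneg D0) auto
    ultimately show ?thesis by simp
  qed
qed

lemma noise_integrable_bounded:
  fixes h :: "(int \<Rightarrow> nat \<Rightarrow> real) \<Rightarrow> real"
  assumes "h \<in> borel_measurable noise_space" "\<And>\<omega>. \<bar>h \<omega>\<bar> \<le> C"
  shows "integrable noise_space h"
  using assms by (intro noise.integrable_const_bound[where B = C]) auto

text \<open>The condition on \<open>k\<close> makes the event that two jumps meet in a block of length \<open>k\<close> negligible
  even after multiplication by the maximal value \<open>k\<^sup>p\<close>.\<close>

lemma expectation_number_of_jumps_powr_le:
  assumes p: "0 < p" "p \<le> real q" and k: "k ^ Suc q \<le> 2 ^ Suc l"
  shows "integrable noise_space (\<lambda>\<omega>. (\<Sum>s<k. \<bar>jump l (\<omega> (- int s))\<bar>) powr p)"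
    and "noise.expectation (\<lambda>\<omega>. (\<Sum>s<k. \<bar>jump l (\<omega> (- int s))\<bar>) powr p) \<le> 2 * real k / 2 ^ Suc l"
proof -
  let ?x = "\<lambda>\<omega> s. \<bar>jump l (\<omega> (- int s))\<bar>"
  define e :: real where "e = 1 / 2 ^ Suc l"
  let ?D = "\<lambda>\<omega>. \<Sum>s<k. \<Sum>t\<in>{..<k} - {s}. ?x \<omega> s * ?x \<omega> t"
  have x1: "\<bar>jump l u\<bar> \<le> 1" for u by (simp add: abs_jump)
  have i1: "integrable noise_space (\<lambda>\<omega>. ?x \<omega> s)" for s
    by (rule noise_integrable_bounded[where C = 1]) (auto simp: x1)
  have i2: "integrable noise_space (\<lambda>\<omega>. ?x \<omega> s * ?x \<omega> t)" for s t
    by (rule noise_integrable_bounded[where C = 1]) (auto simp: abs_mult x1 intro!: mult_le_one)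
  have le: "(\<Sum>s<k. ?x \<omega> s) powr p \<le> (\<Sum>s<k. ?x \<omega> s) + real k ^ q * ?D \<omega>" for \<omega>
    by (rule sum_01_powr_le[OF _ p]) (simp add: abs_jump)
  have int: "integrable noise_space (\<lambda>\<omega>. (\<Sum>s<k. ?x \<omega> s) + real k ^ q * ?D \<omega>)"
    by (intro Bochner_Integration.integrable_add integrable_mult_right Bochner_Integration.integrable_sum i1 i2)
  show i: "integrable noise_space (\<lambda>\<omega>. (\<Sum>s<k. ?x \<omega> s) powr p)"
    by (rule Bochner_Integration.integrable_bound[OF int])
       (auto intro!: AE_I2 order_trans[OF le])
  have "noise.expectation (\<lambda>\<omega>. (\<Sum>s<k. ?x \<omega> s) powr p)
      \<le> noise.expectation (\<lambda>\<omega>. (\<Sum>s<k. ?x \<omega> s) + real k ^ q * ?D \<omega>)"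
    by (intro integral_mono i int le)
  also have "\<dots> = (\<Sum>s<k. noise.expectation (\<lambda>\<omega>. ?x \<omega> s))
      + real k ^ q * (\<Sum>s<k. \<Sum>t\<in>{..<k} - {s}. noise.expectation (\<lambda>\<omega>. ?x \<omega> s * ?x \<omega> t))"
    by (simp add: Bochner_Integration.integral_add Bochner_Integration.integral_sum i1 i2)
  also have "(\<Sum>s<k. \<Sum>t\<in>{..<k} - {s}. noise.expectation (\<lambda>\<omega>. ?x \<omega> s * ?x \<omega> t))
      = (\<Sum>s<k. \<Sum>t\<in>{..<k} - {s}. e\<^sup>2)"
    unfolding e_def by (intro sum.cong refl expectation_jump_pair) auto
  finally have E: "noise.expectation (\<lambda>\<omega>. (\<Sum>s<k. ?x \<omega> s) powr p)
      \<le> real k * e + real k ^ q * (\<Sum>s<k. \<Sum>t\<in>{..<k} - {s}. e\<^sup>2)"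
    by (simp add: expectation_jump e_def)
  have e0: "0 \<le> e" by (simp add: e_def)
  have "(\<Sum>t\<in>{..<k} - {s}. e\<^sup>2) \<le> real k * e\<^sup>2" for s
  proof -
    have "card ({..<k} - {s}) \<le> k" by (metis card_Diff1_le card_lessThan finite_lessThan)
    then show ?thesis by (simp add: mult_right_mono)
  qed
  then have "(\<Sum>s<k. \<Sum>t\<in>{..<k} - {s}. e\<^sup>2) \<le> real (card {..<k}) * (real k * e\<^sup>2)"
    by (intro sum_bounded_above) blast
  then have "real k ^ q * (\<Sum>s<k. \<Sum>t\<in>{..<k} - {s}. e\<^sup>2) \<le> real k ^ q * (real k * (real k * e\<^sup>2))"
    by (intro mult_left_mono) simp_all
  \<comment> \<open>The condition on k enters here: k^q times the pair term k^2 e^2 is at most k e,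
    the size of the first-order term. Hence the factor 2 in the result.\<close>
  also have "\<dots> = (real k ^ Suc q * e) * (real k * e)"
    by (simp add: power2_eq_square)
  also have "\<dots> \<le> 1 * (real k * e)"
  proof (intro mult_right_mono)
    have "real (k ^ Suc q) \<le> real (2 ^ Suc l)" using k of_nat_le_iff by blast
    then show "real k ^ Suc q * e \<le> 1" by (simp add: e_def divide_le_eq)
  qed (simp add: e0)
  finally show "noise.expectation (\<lambda>\<omega>. (\<Sum>s<k. ?x \<omega> s) powr p) \<le> 2 * real k / 2 ^ Suc l"
    using E by (simp add: e_def)
qed

section \<open>Choice of the block lengths\<close>

text \<open>The terms are m^(-1/2) up to m = k and k m^(-3/2) afterwards. Both parts are compared
  with telescoping differences and contribute at most 2 sqrt k each. The norm of a block carries a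
  factor k^(-1/2), which cancels this growth.\<close>

lemma weight_sum_le:
  fixes k :: nat
  assumes "k \<ge> 1"
  shows "(\<Sum>m<M. real (min (Suc m) k) / real (Suc m) powr (3/2)) \<le> 4 * sqrt (real k)"
proof -
  have step1: "1 / sqrt (real (Suc m)) \<le> 2 * (sqrt (real (Suc m)) - sqrt (real m))" for m
  proof -
    have "(sqrt (real (Suc m)) - sqrt (real m)) * (sqrt (real (Suc m)) + sqrt (real m)) = 1"
      by (simp add: algebra_simps)
    moreover have "sqrt (real m) \<le> sqrt (real (Suc m))" by simp
    ultimately have "1 \<le> (sqrt (real (Suc m)) - sqrt (real m)) * (2 * sqrt (real (Suc m)))"
      by (metis add_le_cancel_left diff_ge_0_iff_ge mult_2 mult_left_mono)
    moreover have "0 < sqrt (real (Suc m))" by simp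
    ultimately show ?thesis by (simp only: pos_divide_le_eq mult_ac)
  qed
  have pow: "real (Suc m) powr (3/2) = real (Suc m) * sqrt (real (Suc m))" for m
    using powr_add[of "real (Suc m)" 1 "1/2"] by (simp add: powr_half_sqrt)
  have small: "(\<Sum>m<M. real (min (Suc m) k) / real (Suc m) powr (3/2)) \<le> 2 * sqrt (real M)"
    if "M \<le> k" for M
    using that
  proof (induction M)
    case (Suc M)
    have "real (min (Suc M) k) / real (Suc M) powr (3/2) = 1 / sqrt (real (Suc M))"
      using Suc.prems unfolding pow by (simp add: min_def)
    then show ?case using Suc step1[of M] by simp
  qed simp
  \<comment> \<open>The subtracted term makes the induction work: it is the part of the telescoping
    tail not yet consumed, and at M = k the bound reduces to the 2 sqrt k of
    \<open>small\<close>.\<close>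
  have large: "(\<Sum>m<M. real (min (Suc m) k) / real (Suc m) powr (3/2))
      \<le> 4 * sqrt (real k) - 2 * real k / sqrt (real M)" if "k \<le> M" for M
    using that
  proof (induction M rule: dec_induct)
    case base
    have "real k / sqrt (real k) = sqrt (real k)" by (simp add: real_div_sqrt)
    then show ?case using small[of k] by simp
  next
    case (step M)
    have M: "0 < M" using step assms by simp
    have "1 / real (Suc M) powr (3/2) \<le> 2 / sqrt (real M) - 2 / sqrt (real (Suc M))"
    proof -
      let ?a = "sqrt (real M)" and ?b = "sqrt (real (Suc M))"
      have ab: "0 < ?a" "?a \<le> ?b" "0 < ?b" using M by auto
      have "1 / real (Suc M) powr (3/2) = (1 / ?b) / (?b * ?b)" unfolding pow by simp
      also have "\<dots> \<le> (2 * (?b - ?a)) / (?a * ?b)"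
        using ab step1[of M] by (intro frac_le mult_right_mono) auto
      also have "\<dots> = 2 / ?a - 2 / ?b" using ab by (simp add: field_simps)
      finally show ?thesis .
    qed
    then have "real k * (1 / real (Suc M) powr (3/2)) \<le> real k * (2 / sqrt (real M) - 2 / sqrt (real (Suc M)))"
      by (intro mult_left_mono) auto
    moreover have "real (min (Suc M) k) / real (Suc M) powr (3/2) = real k * (1 / real (Suc M) powr (3/2))"
      using step by (simp add: min_def)
    ultimately show ?case using step.IH by (simp add: algebra_simps)
  qed
  show ?thesis
  proof (cases "M \<le> k")
    case True
    then have "sqrt (real M) \<le> sqrt (real k)" by simp
    then show ?thesis using small[OF True] real_sqrt_ge_zero[of "real k"] by linarith
  next
    case False
    have "0 \<le> 2 * real k / sqrt (real M)" by simp
    then show ?thesis using large[of M] False by linarith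
  qed
qed

text \<open>The indices m < N contribute at most a constant C independent of k, which is at most
  \<eta>/2 * sqrt k for large k. Beyond N the weights are below \<eta>/8, and
  \<open>weight_sum_le\<close> turns this into another \<eta>/2 * sqrt k.\<close>

lemma weighted_sum_small:
  fixes a :: "nat \<Rightarrow> real"
  assumes "a \<longlonglongrightarrow> 0" "\<eta> > 0"
  shows "\<exists>K. \<forall>k\<ge>K. \<forall>M. (\<Sum>m<M. \<bar>a (Suc m)\<bar> * (real (min (Suc m) k) / real (Suc m) powr (3/2)))
            \<le> \<eta> * sqrt (real k)"
proof -
  let ?w = "\<lambda>k m. real (min (Suc m) k) / real (Suc m) powr (3/2)"
  have w0: "0 \<le> ?w k m" for k m by simp
  obtain N where N: "\<And>m. m \<ge> N \<Longrightarrow> \<bar>a m\<bar> < \<eta> / 8"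
    using LIMSEQ_D[OF assms(1), of "\<eta> / 8"] assms(2) by auto
  define C where "C = (\<Sum>m<N. \<bar>a (Suc m)\<bar> * real (Suc m))"
  have "filterlim (\<lambda>k. sqrt (real k)) at_top sequentially"
    by (rule filterlim_compose[OF sqrt_at_top filterlim_real_sequentially])
  then have "\<forall>\<^sub>F k in sequentially. 2 * C / \<eta> \<le> sqrt (real k)"
    by (simp add: filterlim_at_top)
  then obtain K where K: "\<And>k. k \<ge> K \<Longrightarrow> 2 * C / \<eta> \<le> sqrt (real k)"
    by (auto simp: eventually_sequentially)
  have "(\<Sum>m<M. \<bar>a (Suc m)\<bar> * ?w k m) \<le> \<eta> * sqrt (real k)" if k: "k \<ge> max K 1" for k M
  proof -
    have le: "\<bar>a (Suc m)\<bar> * ?w k m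
        \<le> (if m < N then \<bar>a (Suc m)\<bar> * real (Suc m) else 0) + \<eta> / 8 * ?w k m" for m
    proof (cases "m < N")
      case True
      have "1 \<le> real (Suc m) powr (3/2)" by (rule ge_one_powr_ge_zero) auto
      then have "?w k m \<le> real (min (Suc m) k) / 1" by (intro divide_left_mono) auto
      also have "\<dots> \<le> real (Suc m)" by simp
      finally have "\<bar>a (Suc m)\<bar> * ?w k m \<le> \<bar>a (Suc m)\<bar> * real (Suc m)" by (intro mult_left_mono) auto
      moreover have "0 \<le> \<eta> / 8 * ?w k m" using assms(2) by simp
      ultimately show ?thesis unfolding if_P[OF True] by linarith
    next
      case False
      then have "\<bar>a (Suc m)\<bar> \<le> \<eta> / 8" using N[of "Suc m"] by simp
      from mult_right_mono[OF this w0[of m k]] show ?thesis using False by simp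
    qed
    have "(\<Sum>m<M. \<bar>a (Suc m)\<bar> * ?w k m)
        \<le> (\<Sum>m<M. (if m < N then \<bar>a (Suc m)\<bar> * real (Suc m) else 0) + \<eta> / 8 * ?w k m)"
      by (intro sum_mono le)
    also have "\<dots> = (\<Sum>m<M. if m < N then \<bar>a (Suc m)\<bar> * real (Suc m) else 0) + \<eta> / 8 * (\<Sum>m<M. ?w k m)"
      by (simp add: sum.distrib sum_distrib_left)
    also have "(\<Sum>m<M. if m < N then \<bar>a (Suc m)\<bar> * real (Suc m) else 0)
        = (\<Sum>m\<in>{..<M} \<inter> {..<N}. \<bar>a (Suc m)\<bar> * real (Suc m))"
      by (simp add: sum.inter_restrict cong: if_cong)
    also have "\<dots> \<le> C"
      unfolding C_def by (intro sum_mono2) auto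
    also have "C \<le> \<eta> / 2 * sqrt (real k)"
      using K[of k] k assms(2) by (simp add: field_simps)
    also have "(\<Sum>m<M. ?w k m) \<le> 4 * sqrt (real k)" using k by (intro weight_sum_le) simp
    finally show ?thesis using assms(2) by simp
  qed
  then show ?thesis by blast
qed

text \<open>Powers of two are needed to match the frequencies of the levels. The factors (1/4)^i and
  the growth b i \<ge> 4 i compensate the weights \<open>2 ^ Suc i\<close> of the crude Minkowski
  inequality. The summand 1 keeps every exponent positive, so that the subtraction in
  \<open>lev\<close> does not truncate and two blocks fit into a period.\<close>

lemma exists_block_exponents:
  fixes a :: "nat \<Rightarrow> real"
  assumes "a \<longlonglongrightarrow> 0"
  shows "\<exists>b :: nat \<Rightarrow> nat. strict_mono b \<and> (\<forall>i. 4 * i + 1 \<le> b i) \<and>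
    (\<forall>i M. (\<Sum>m<M. \<bar>a (Suc m)\<bar> * (real (min (Suc m) (2 ^ b i)) / real (Suc m) powr (3/2)))
            \<le> (1/4) ^ i * sqrt (2 ^ b i))"
proof -
  let ?P = "\<lambda>i b. 4 * i + 1 \<le> b \<and>
    (\<forall>M. (\<Sum>m<M. \<bar>a (Suc m)\<bar> * (real (min (Suc m) (2 ^ b)) / real (Suc m) powr (3/2)))
            \<le> (1/4) ^ i * sqrt (2 ^ b))"
  have ex: "\<exists>b'>b. ?P i b'" for i b :: nat
  proof -
    have "(0::real) < (1/4) ^ i" by simp
    then obtain K where K: "\<And>k M. k \<ge> K \<Longrightarrow>
        (\<Sum>m<M. \<bar>a (Suc m)\<bar> * (real (min (Suc m) k) / real (Suc m) powr (3/2))) \<le> (1/4) ^ i * sqrt (real k)"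
      using weighted_sum_small[OF assms] by blast
    let ?b = "max (max K (Suc b)) (4 * i + 1)"
    have "K \<le> 2 ^ ?b" using less_exp[of ?b] by linarith
    then have "?P i ?b" using K[of "2 ^ ?b"] by simp
    then show ?thesis by (intro exI[of _ ?b]) auto
  qed
  have "\<exists>b. \<forall>i. ?P i (b i) \<and> b i < b (Suc i)"
    by (rule dependent_nat_choice) (use ex in blast)+
  then show ?thesis by (auto simp: strict_mono_Suc_iff)
qed

section \<open>The superposition of moving averages\<close>

lemma distr_funpow:
  assumes "T \<in> measurable M M" "distr M M T = M"
  shows "T ^^ j \<in> measurable M M" "distr M M (T ^^ j) = M"
proof (induction j)
  case 0
  { case 1 show ?case by simp }
  { case 2 show ?case by (simp add: distr_id2) }
next
  case (Suc j)
  have T: "T ^^ Suc j = T \<circ> T ^^ j" by simp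
  { case 1 show ?case unfolding T using Suc(1) assms(1) by (rule measurable_comp) }
  { case 2 show ?case unfolding T distr_distr[OF assms(1) Suc(1), symmetric] Suc(2) by (rule assms(2)) }
qed

lemma strictly_stationary_funpow:
  assumes T: "T \<in> measurable M M" "distr M M T = M" and f [measurable]: "f \<in> borel_measurable M"
  shows "strictly_stationary M (\<lambda>j \<omega>. f ((T ^^ j) \<omega>))"
proof -
  note [measurable] = distr_funpow(1)[OF T]
  let ?B = "\<Pi>\<^sub>M j\<in>(UNIV :: nat set). (borel :: real measure)"
  have X: "(\<lambda>\<omega> j. f ((T ^^ j) \<omega>)) \<in> measurable M ?B"
  proof -
    have "(\<lambda>\<omega>. \<lambda>j\<in>UNIV. f ((T ^^ j) \<omega>)) \<in> measurable M ?B"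
      by (rule measurable_restrict) simp
    then show ?thesis by (simp add: restrict_UNIV)
  qed
  have "distr M ?B (\<lambda>\<omega> j. f ((T ^^ (j + k)) \<omega>)) = distr M ?B (\<lambda>\<omega> j. f ((T ^^ j) \<omega>))" for k
  proof -
    have "distr M ?B (\<lambda>\<omega> j. f ((T ^^ j) \<omega>)) = distr (distr M M (T ^^ k)) ?B (\<lambda>\<omega> j. f ((T ^^ j) \<omega>))"
      by (simp add: distr_funpow(2)[OF T])
    also have "\<dots> = distr M ?B ((\<lambda>\<omega> j. f ((T ^^ j) \<omega>)) \<circ> T ^^ k)"
      by (rule distr_distr[OF X]) simp
    finally show ?thesis by (simp add: funpow_add o_def)
  qed
  then show ?thesis by (simp add: strictly_stationary_def)
qed

text \<open>A jump of level \<open>lev i\<close> contributes \<open>\<plusminus>amp i\<close> to \<open>2 ^ b i\<close> consecutive values of the process; on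
  average there is one such jump in \<open>2 ^ Suc (lev i) = (2 ^ b i) ^ Suc q\<close> sites.\<close>

locale jump_process =
  fixes p :: real and q :: nat and b :: "nat \<Rightarrow> nat"
  assumes p: "p > 2" "p \<le> real q" and b_mono: "strict_mono b" and b_ge: "4 * i + 1 \<le> b i"
begin

section \<open>The process and its projections onto the past\<close>

definition lev :: "nat \<Rightarrow> nat" where "lev i = b i * Suc q - 1"

definition amp :: "nat \<Rightarrow> real" where
  "amp i = (2 ^ Suc (lev i)) powr (1 / p) * (2 ^ b i) powr (- 1 / 2 - 1 / p)"

text \<open>This will be the level i part of the conditional expectation of the m-step sum. A past
  jump at site -s enters the value at time j when j + s < 2 ^ b i, which holds for
  \<open>min m (2 ^ b i - s)\<close> of the times j < m. For m = 1 all weights are 1, which gives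
  the moving average itself.\<close>

definition block :: "nat \<Rightarrow> nat \<Rightarrow> (int \<Rightarrow> nat \<Rightarrow> real) \<Rightarrow> real" where
  "block m i \<omega> = amp i * (\<Sum>s<2 ^ b i. real (min m (2 ^ b i - s)) * jump (lev i) (\<omega> (- int s)))"

text \<open>Convergence of the series is established only almost everywhere. At the remaining points
  \<open>suminf\<close> still returns a value determined by the terms, hence by the sites r \<le> 0,
  so past measurability holds everywhere.\<close>

definition proj :: "nat \<Rightarrow> (int \<Rightarrow> nat \<Rightarrow> real) \<Rightarrow> real" where
  "proj m \<omega> = (\<Sum>i. block m i \<omega>)"

abbreviation f :: "(int \<Rightarrow> nat \<Rightarrow> real) \<Rightarrow> real" where "f \<equiv> proj (Suc 0)"

lemma period: "2 ^ Suc (lev i) = (2 ^ b i :: 'a :: comm_semiring_1) ^ Suc q"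
proof -
  have "Suc (lev i) = b i * Suc q" using b_ge[of i] by (simp add: lev_def)
  then show ?thesis by (simp only: power_mult)
qed

lemma inj_lev: "lev i = lev i' \<Longrightarrow> i = i'"
proof -
  assume "lev i = lev i'"
  moreover have "Suc (lev i) = b i * Suc q" "Suc (lev i') = b i' * Suc q"
    using b_ge[of i] b_ge[of i'] by (simp_all add: lev_def)
  ultimately have "b i = b i'" by (metis mult_cancel2 nat.distinct(1))
  then show "i = i'" using b_mono strict_mono_eq by blast
qed

lemma amp_pos: "amp i > 0"
  by (simp add: amp_def)

lemma measurable_jump [measurable]: "(\<lambda>\<omega>. jump l (\<omega> r)) \<in> borel_measurable noise_space"
  by (rule measurable_site)

lemma measurable_block [measurable]: "block m i \<in> borel_measurable noise_space"
  unfolding block_def by measurable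

lemma measurable_proj [measurable]: "proj m \<in> borel_measurable noise_space"
  unfolding proj_def by measurable

lemma measurable_proj_past: "proj m \<in> borel_measurable past"
proof (rule measurable_pastI[OF measurable_proj])
  fix \<omega> \<omega>' :: "int \<Rightarrow> nat \<Rightarrow> real" assume "\<And>r. r \<le> 0 \<Longrightarrow> \<omega> r = \<omega>' r"
  then show "proj m \<omega> = proj m \<omega>'" by (simp add: proj_def block_def)
qed

text \<open>With k = 2 ^ b i and n = 2 ^ Suc (lev i), a block is at most amp * min(m, k) times the
  number of jumps, whose p-th moment is at most 2 k / n. The amplitude satisfies amp^p k / n =
  k^(-p/2), so n drops out.\<close>

lemma block_Lp:
  shows "in_Lp p noise_space (block m i)"
    and "noise.expectation (\<lambda>\<omega>. \<bar>block m i \<omega>\<bar> powr p) \<le> (2 * (real (min m (2 ^ b i)) / sqrt (2 ^ b i))) powr p"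
proof -
  let ?k = "2 ^ b i :: nat" and ?J = "\<lambda>\<omega> s. jump (lev i) (\<omega> (- int s))"
  let ?N = "\<lambda>\<omega>. \<Sum>s<?k. \<bar>?J \<omega> s\<bar>" and ?c = "real (min m ?k)"
  have k: "?k ^ Suc q \<le> 2 ^ Suc (lev i)" by (simp only: period)
  note N = expectation_number_of_jumps_powr_le[OF _ p(2) k]
  have le: "\<bar>block m i \<omega>\<bar> powr p \<le> (amp i * ?c) powr p * ?N \<omega> powr p" for \<omega>
  proof -
    have "\<bar>\<Sum>s<?k. real (min m (?k - s)) * ?J \<omega> s\<bar> \<le> (\<Sum>s<?k. ?c * \<bar>?J \<omega> s\<bar>)"
      by (intro order_trans[OF sum_abs] sum_mono) (auto simp: abs_mult intro!: mult_right_mono)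
    then have "\<bar>block m i \<omega>\<bar> \<le> amp i * (\<Sum>s<?k. ?c * \<bar>?J \<omega> s\<bar>)"
      using amp_pos[of i] by (simp add: block_def abs_mult)
    also have "\<dots> = (amp i * ?c) * ?N \<omega>" by (simp add: sum_distrib_left mult.assoc)
    finally have "\<bar>block m i \<omega>\<bar> powr p \<le> ((amp i * ?c) * ?N \<omega>) powr p"
      using p by (intro powr_mono2) auto
    also have "\<dots> = (amp i * ?c) powr p * ?N \<omega> powr p"
      by (rule powr_mult)
    finally show ?thesis .
  qed
  have int: "integrable noise_space (\<lambda>\<omega>. (amp i * ?c) powr p * ?N \<omega> powr p)"
    using N(1) p by simp
  have int': "integrable noise_space (\<lambda>\<omega>. \<bar>block m i \<omega>\<bar> powr p)"
    by (rule Bochner_Integration.integrable_bound[OF int]) (auto intro!: AE_I2 le)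
  then show "in_Lp p noise_space (block m i)" by (simp add: in_Lp_def)
  have "noise.expectation (\<lambda>\<omega>. \<bar>block m i \<omega>\<bar> powr p) \<le> (amp i * ?c) powr p * noise.expectation (\<lambda>\<omega>. ?N \<omega> powr p)"
    using integral_mono[OF int' int le] by simp
  also have "\<dots> \<le> (amp i * ?c) powr p * (2 * real ?k / 2 ^ Suc (lev i))"
    using N(2) p by (intro mult_left_mono) auto
  also have "\<dots> = (amp i powr p * real ?k / 2 ^ Suc (lev i)) * (2 * ?c powr p)"
    using amp_pos[of i] by (simp add: powr_mult)
  also have "amp i powr p * real ?k / 2 ^ Suc (lev i) = (1 / sqrt (2 ^ b i)) powr p"
  proof -
    have "amp i powr p = 2 ^ Suc (lev i) * (2 ^ b i) powr (- p / 2 - 1)"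
      using p by (simp add: amp_def powr_mult powr_powr algebra_simps)
    moreover have "(2 ^ b i :: real) powr (- p / 2 - 1) * 2 ^ b i = (2 ^ b i) powr (- p / 2)"
      using powr_add[of "2 ^ b i :: real" "- p / 2 - 1" 1] by simp
    moreover have "(1 / sqrt (2 ^ b i)) powr p = (2 ^ b i :: real) powr (- p / 2)"
      by (simp add: powr_half_sqrt[symmetric] powr_divide powr_powr powr_minus_divide)
    ultimately show ?thesis by (simp del: power_Suc)
  qed
  also have "(1 / sqrt (2 ^ b i)) powr p * (2 * ?c powr p) \<le> (1 / sqrt (2 ^ b i)) powr p * (2 powr p * ?c powr p)"
  proof -
    have "(2::real) powr 1 \<le> 2 powr p" using p by (intro powr_mono) auto
    then show ?thesis by (intro mult_left_mono mult_right_mono) auto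
  qed
  also have "\<dots> = (2 * (?c / sqrt (2 ^ b i))) powr p"
    by (simp add: powr_mult powr_divide)
  finally show "noise.expectation (\<lambda>\<omega>. \<bar>block m i \<omega>\<bar> powr p) \<le> (2 * (real (min m (2 ^ b i)) / sqrt (2 ^ b i))) powr p"
    by simp
qed

lemma inverse_sqrt_length_le: "1 / sqrt (2 ^ b i) \<le> (1 / 4) ^ i"
proof -
  have "(4 ^ i)\<^sup>2 = (2 :: real) ^ (4 * i)" by (simp add: power_mult power2_eq_square flip: power_mult_distrib)
  also have "\<dots> \<le> 2 ^ b i" using b_ge[of i] by (intro power_increasing) auto
  finally have "4 ^ i \<le> sqrt (2 ^ b i)" by (rule real_le_rsqrt)
  then show ?thesis by (simp add: power_divide frac_le)
qed

lemma summable_block_bounds: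
  "summable (\<lambda>i. 2 ^ Suc i * (2 * (real (min m (2 ^ b i)) / sqrt (2 ^ b i))))"
proof (rule summable_comparison_test')
  show "summable (\<lambda>i. 4 * real m * (1 / 2) ^ i)" by (intro summable_mult summable_geometric) simp
  fix i
  have "real (min m (2 ^ b i)) * (1 / sqrt (2 ^ b i)) \<le> real m * (1 / 4) ^ i"
    by (intro mult_mono inverse_sqrt_length_le) auto
  then have "real (min m (2 ^ b i)) / sqrt (2 ^ b i) \<le> real m * (1 / 4) ^ i" by simp
  then have "2 ^ Suc i * (2 * (real (min m (2 ^ b i)) / sqrt (2 ^ b i))) \<le> 2 ^ Suc i * (2 * (real m * (1 / 4) ^ i))"
    by (intro mult_left_mono) simp_all
  also have "\<dots> = 4 * real m * (1 / 2) ^ i"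
    using power_mult_distrib[of 2 "1/4 :: real" i] by simp
  finally show "norm (2 ^ Suc i * (2 * (real (min m (2 ^ b i)) / sqrt (2 ^ b i)))) \<le> 4 * real m * (1 / 2) ^ i"
    by simp
qed

lemma
  shows AE_summable_block: "AE \<omega> in noise_space. summable (\<lambda>i. \<bar>block m i \<omega>\<bar>)"
    and proj_in_Lp: "in_Lp p noise_space (proj m)"
    and Lp_norm_proj_le: "Lp_norm p noise_space (proj m)
          \<le> (\<Sum>i. 2 ^ Suc i * (2 * (real (min m (2 ^ b i)) / sqrt (2 ^ b i))))"
  unfolding proj_def
  by (rule Lp_norm_suminf_le[OF _ block_Lp(1) _ block_Lp(2) summable_block_bounds];
      use p in simp)+

text \<open>Flips and powers of the shift preserve the measure, so convergence almost everywhere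
  passes to all points of a flipped orbit simultaneously. The orbit without a flip is the case
  \<open>R = {}\<close>.\<close>

lemma AE_summable_shifted:
  "AE \<omega> in noise_space. \<forall>j. summable (\<lambda>i. \<bar>block (Suc 0) i ((left_shift ^^ j) (flip R \<omega>))\<bar>)"
  unfolding AE_all_countable
proof
  fix j
  let ?F = "(left_shift ^^ j) \<circ> flip R"
  have m: "?F \<in> measurable noise_space noise_space"
    using measurable_flip distr_funpow(1)[OF measurable_shift distr_shift] by (rule measurable_comp)
  have "distr noise_space noise_space ?F = noise_space"
    using distr_distr[OF distr_funpow(1)[OF measurable_shift distr_shift, of j] measurable_flip[of R]]
    by (simp add: distr_flip distr_funpow(2)[OF measurable_shift distr_shift])
  then have "AE \<omega> in distr noise_space noise_space ?F. summable (\<lambda>i. \<bar>block (Suc 0) i \<omega>\<bar>)"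
    using AE_summable_block[of "Suc 0"] by (simp only:)
  from AE_distrD[OF m this]
  show "AE \<omega> in noise_space. summable (\<lambda>i. \<bar>block (Suc 0) i ((left_shift ^^ j) (flip R \<omega>))\<bar>)" by simp
qed

section \<open>Conditional expectations by flipping the future\<close>

lemma flip_empty [simp]: "flip {} \<omega> = \<omega>"
  by (simp add: flip_def)

lemma block_Suc_0_shift:
  "block (Suc 0) i ((left_shift ^^ j) \<omega>) = amp i * (\<Sum>s<2 ^ b i. jump (lev i) (\<omega> (int j - int s)))"
proof -
  have "(\<Sum>s<2 ^ b i. real (min (Suc 0) (2 ^ b i - s)) * jump (lev i) ((left_shift ^^ j) \<omega> (- int s)))
      = (\<Sum>s<2 ^ b i. jump (lev i) (\<omega> (int j - int s)))"
    by (intro sum.cong refl) (auto simp: shift_funpow min_def)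
  then show ?thesis by (simp add: block_def)
qed

text \<open>At time j, position s of the window is site j - s, which lies in the past when j \<le>
  s. Collecting the terms by site instead of by time produces the weights of
  \<open>block\<close>.\<close>

lemma sum_jump_past:
  fixes x :: "nat \<Rightarrow> real"
  shows "(\<Sum>j<m. \<Sum>s<k. if j \<le> s then x (s - j) else 0) = (\<Sum>s<k. real (min m (k - s)) * x s)"
proof -
  have "(\<Sum>s<k. if j \<le> s then x (s - j) else 0) = (\<Sum>s<k. if j + s < k then x s else 0)" for j
  proof -
    have "(\<Sum>s<k. if j \<le> s then x (s - j) else 0) = (\<Sum>s\<in>{j..<k}. x (s - j))"
      by (intro sum.mono_neutral_cong_right) auto
    also have "\<dots> = (\<Sum>s\<in>{..<k - j}. x s)"
      by (rule sum.reindex_bij_witness[of _ "\<lambda>s. s + j" "\<lambda>s. s - j"]) auto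
    also have "\<dots> = (\<Sum>s<k. if j + s < k then x s else 0)"
      by (intro sum.mono_neutral_cong_left) auto
    finally show ?thesis .
  qed
  then have "(\<Sum>j<m. \<Sum>s<k. if j \<le> s then x (s - j) else 0) = (\<Sum>s<k. \<Sum>j<m. if j + s < k then x s else 0)"
    by (subst sum.swap) simp
  also have "\<dots> = (\<Sum>s<k. real (min m (k - s)) * x s)"
  proof (intro sum.cong refl)
    fix s
    have "(\<Sum>j<m. if j + s < k then x s else 0) = (\<Sum>j<min m (k - s). x s)"
      by (intro sum.mono_neutral_cong_right) auto
    then show "(\<Sum>j<m. if j + s < k then x s else 0) = real (min m (k - s)) * x s" by simp
  qed
  finally show ?thesis .
qed

text \<open>The jumps at positive sites cancel.\<close>

lemma block_flip_future:
  "(\<Sum>j<m. block (Suc 0) i ((left_shift ^^ j) \<omega>)) + (\<Sum>j<m. block (Suc 0) i ((left_shift ^^ j) (flip {1..} \<omega>)))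
     = 2 * block m i \<omega>"
proof -
  let ?J = "\<lambda>r. jump (lev i) (\<omega> r)"
  have "(\<Sum>j<m. block (Suc 0) i ((left_shift ^^ j) \<omega>)) + (\<Sum>j<m. block (Suc 0) i ((left_shift ^^ j) (flip {1..} \<omega>)))
      = 2 * amp i * (\<Sum>j<m. \<Sum>s<2 ^ b i. (?J (int j - int s) + jump (lev i) (flip {1..} \<omega> (int j - int s))) / 2)"
    unfolding block_Suc_0_shift
    by (simp add: sum.distrib[symmetric] sum_distrib_left distrib_left add_divide_distrib mult.assoc)
  also have "(\<Sum>j<m. \<Sum>s<2 ^ b i. (?J (int j - int s) + jump (lev i) (flip {1..} \<omega> (int j - int s))) / 2)
      = (\<Sum>j<m. \<Sum>s<2 ^ b i. if j \<le> s then ?J (- int (s - j)) else 0)"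
    by (intro sum.cong refl) (auto simp: jump_flip of_nat_diff)
  also have "\<dots> = (\<Sum>s<2 ^ b i. real (min m (2 ^ b i - s)) * ?J (- int s))"
    by (rule sum_jump_past)
  finally show ?thesis by (simp add: block_def)
qed

lemma ergodic_sum_eq_suminf:
  assumes "\<forall>j. summable (\<lambda>i. \<bar>block (Suc 0) i ((left_shift ^^ j) \<omega>)\<bar>)" "finite A"
  shows "summable (\<lambda>i. \<Sum>j\<in>A. block (Suc 0) i ((left_shift ^^ j) \<omega>))"
    and "(\<Sum>j\<in>A. f ((left_shift ^^ j) \<omega>)) = (\<Sum>i. \<Sum>j\<in>A. block (Suc 0) i ((left_shift ^^ j) \<omega>))"
proof -
  have s: "summable (\<lambda>i. block (Suc 0) i ((left_shift ^^ j) \<omega>))" for j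
    by (rule summable_rabs_cancel[OF spec[OF assms(1)]])
  show "summable (\<lambda>i. \<Sum>j\<in>A. block (Suc 0) i ((left_shift ^^ j) \<omega>))" by (rule summable_sum[OF s])
  show "(\<Sum>j\<in>A. f ((left_shift ^^ j) \<omega>)) = (\<Sum>i. \<Sum>j\<in>A. block (Suc 0) i ((left_shift ^^ j) \<omega>))"
    unfolding proj_def by (rule suminf_sum[symmetric]) (rule s)
qed

lemma AE_ergodic_sum_flip:
  "AE \<omega> in noise_space.
     ergodic_sum left_shift f m \<omega> + ergodic_sum left_shift f m (flip {1..} \<omega>) = 2 * proj m \<omega>"
  using AE_summable_shifted[of "{}"] AE_summable_shifted[of "{1..}"]
proof eventually_elim
  case (elim \<omega>)
  then have e: "\<forall>j. summable (\<lambda>i. \<bar>block (Suc 0) i ((left_shift ^^ j) \<omega>)\<bar>)" by simp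
  note 1 = ergodic_sum_eq_suminf[OF e, of "{..<m}"]
  note 2 = ergodic_sum_eq_suminf[OF elim(2), of "{..<m}"]
  have "ergodic_sum left_shift f m \<omega> + ergodic_sum left_shift f m (flip {1..} \<omega>)
      = (\<Sum>i. 2 * block m i \<omega>)"
    unfolding ergodic_sum_def 1(2)[OF finite_lessThan] 2(2)[OF finite_lessThan]
      suminf_add[OF 1(1)[OF finite_lessThan] 2(1)[OF finite_lessThan]] block_flip_future ..
  also have "\<dots> = 2 * proj m \<omega>"
  proof -
    have "summable (\<lambda>i. 2 * block m i \<omega>)"
      using summable_add[OF 1(1)[OF finite_lessThan] 2(1)[OF finite_lessThan]]
      unfolding block_flip_future .
    then have "summable (\<lambda>i. block m i \<omega>)" by simp
    then show ?thesis unfolding proj_def by (rule suminf_mult)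
  qed
  finally show ?case .
qed

lemma integrable_proj: "integrable noise_space (proj m)"
  using p by (intro noise.in_Lp_imp_integrable[OF _ proj_in_Lp]) simp

lemma measurable_f_shift [measurable]: "(\<lambda>\<omega>. f ((left_shift ^^ j) \<omega>)) \<in> borel_measurable noise_space"
  by (rule measurable_compose[OF distr_funpow(1)[OF measurable_shift distr_shift] measurable_proj])

lemma integrable_ergodic_sum: "integrable noise_space (ergodic_sum left_shift f m)"
proof -
  have "integrable noise_space (\<lambda>\<omega>. f ((left_shift ^^ j) \<omega>))" for j
  proof -
    have "integrable (distr noise_space noise_space (left_shift ^^ j)) f"
      by (simp add: distr_funpow(2)[OF measurable_shift distr_shift] integrable_proj)
    then show ?thesis
      by (rule integrable_distr[OF distr_funpow(1)[OF measurable_shift distr_shift]])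
  qed
  then show ?thesis unfolding ergodic_sum_def by (intro Bochner_Integration.integrable_sum)
qed

text \<open>Flipping the positive sites preserves the measure and every event of the past. The sum
  and its flip therefore have the same integral over such an event, and their average is almost
  everywhere \<open>proj m\<close>, which is measurable with respect to the past.\<close>

lemma AE_cond_exp:
  "AE \<omega> in noise_space. real_cond_exp noise_space past (ergodic_sum left_shift f m) \<omega> = proj m \<omega>"
proof -
  interpret finite_measure_subalgebra noise_space past
    by standard (rule subalgebra_past)
  let ?S = "ergodic_sum left_shift f m" and ?\<phi> = "flip {1..}"
  note S = integrable_ergodic_sum[of m]
  then have [measurable]: "?S \<in> borel_measurable noise_space" by simp
  show ?thesis
  proof (rule real_cond_exp_charact)
    fix A assume A: "A \<in> sets past"
    then have [measurable]: "A \<in> sets noise_space" by (simp add: sets_past)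
    have int: "integrable noise_space (\<lambda>\<omega>. indicator A \<omega> * ?S \<omega>)"
      using integrable_mult_indicator[OF \<open>A \<in> sets noise_space\<close> S] by simp
    have int': "integrable noise_space (\<lambda>\<omega>. indicator A \<omega> * ?S (?\<phi> \<omega>))"
    proof -
      have "integrable (distr noise_space noise_space ?\<phi>) (\<lambda>\<omega>. indicator A \<omega> * ?S \<omega>)"
        by (simp add: distr_flip int)
      from integrable_distr[OF measurable_flip this] show ?thesis
        by (simp add: indicator_def flip_future_past[OF A])
    qed
    have "noise.expectation (\<lambda>\<omega>. indicator A \<omega> * ?S \<omega>)
        = integral\<^sup>L (distr noise_space noise_space ?\<phi>) (\<lambda>\<omega>. indicator A \<omega> * ?S \<omega>)"
      by (simp add: distr_flip)
    also have "\<dots> = noise.expectation (\<lambda>\<omega>. indicator A (?\<phi> \<omega>) * ?S (?\<phi> \<omega>))"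
      by (rule integral_distr[OF measurable_flip borel_measurable_integrable[OF int]])
    also have "\<dots> = noise.expectation (\<lambda>\<omega>. indicator A \<omega> * ?S (?\<phi> \<omega>))"
      by (simp add: indicator_def flip_future_past[OF A])
    finally have "2 * noise.expectation (\<lambda>\<omega>. indicator A \<omega> * ?S \<omega>)
        = noise.expectation (\<lambda>\<omega>. indicator A \<omega> * ?S \<omega>) + noise.expectation (\<lambda>\<omega>. indicator A \<omega> * ?S (?\<phi> \<omega>))"
      by simp
    also have "\<dots> = noise.expectation (\<lambda>\<omega>. indicator A \<omega> * ?S \<omega> + indicator A \<omega> * ?S (?\<phi> \<omega>))"
      by (rule Bochner_Integration.integral_add[OF int int', symmetric])
    also have "\<dots> = noise.expectation (\<lambda>\<omega>. 2 * (indicator A \<omega> * proj m \<omega>))"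
    proof (rule integral_cong_AE)
      show "AE \<omega> in noise_space. indicator A \<omega> * ?S \<omega> + indicator A \<omega> * ?S (?\<phi> \<omega>) = 2 * (indicator A \<omega> * proj m \<omega>)"
        using AE_ergodic_sum_flip[of m] by eventually_elim (simp add: indicator_def)
      show "(\<lambda>\<omega>. indicator A \<omega> * ?S \<omega> + indicator A \<omega> * ?S (?\<phi> \<omega>)) \<in> borel_measurable noise_space"
        by (intro borel_measurable_add borel_measurable_integrable int int')
    qed measurable
    finally have "noise.expectation (\<lambda>\<omega>. indicator A \<omega> * ?S \<omega>) = noise.expectation (\<lambda>\<omega>. indicator A \<omega> * proj m \<omega>)"
      by simp
    then show "(\<integral>\<omega>\<in>A. ?S \<omega> \<partial>noise_space) = (\<integral>\<omega>\<in>A. proj m \<omega> \<partial>noise_space)"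
      by (simp add: set_lebesgue_integral_def)
  qed (rule S integrable_proj measurable_proj_past)+
qed

lemma Lp_norm_cond_exp_le:
  "Lp_norm p noise_space (real_cond_exp noise_space past (ergodic_sum left_shift f m))
     \<le> (\<Sum>i. 2 ^ Suc i * (2 * (real (min m (2 ^ b i)) / sqrt (2 ^ b i))))"
proof -
  have "(\<integral>\<omega>. \<bar>real_cond_exp noise_space past (ergodic_sum left_shift f m) \<omega>\<bar> powr p \<partial>noise_space)
      = (\<integral>\<omega>. \<bar>proj m \<omega>\<bar> powr p \<partial>noise_space)"
  proof (rule integral_cong_AE)
    have "real_cond_exp noise_space past (ergodic_sum left_shift f m) \<in> borel_measurable noise_space"
      by (rule borel_measurable_cond_exp2)
    then show "(\<lambda>\<omega>. \<bar>real_cond_exp noise_space past (ergodic_sum left_shift f m) \<omega>\<bar> powr p)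
        \<in> borel_measurable noise_space" by measurable
    show "AE \<omega> in noise_space. \<bar>real_cond_exp noise_space past (ergodic_sum left_shift f m) \<omega>\<bar> powr p
        = \<bar>proj m \<omega>\<bar> powr p"
      using AE_cond_exp[of m] by eventually_elim simp
  qed measurable
  then show ?thesis using Lp_norm_proj_le[of m] by (simp add: Lp_norm_def)
qed

text \<open>The convergence is absolute. After exchanging the finite sum over m with the series over
  i, the hypothesis on a cancels the factor 1 / sqrt (2 ^ b i) of level i and leaves 4 * (1/2)^i.
  This bounds the partial sums uniformly.\<close>

lemma summable_cond_exp:
  assumes a: "\<And>i M. (\<Sum>m<M. \<bar>a (Suc m)\<bar> * (real (min (Suc m) (2 ^ b i)) / real (Suc m) powr (3/2)))
            \<le> (1/4) ^ i * sqrt (2 ^ b i)"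
  shows "summable (\<lambda>k. a (Suc k) / real (Suc k) powr (3 / 2) *
    Lp_norm p noise_space (real_cond_exp noise_space past (ergodic_sum left_shift f (Suc k))))"
proof (rule summable_comparison_test')
  define L where "L m = (\<Sum>i. 2 ^ Suc i * (2 * (real (min m (2 ^ b i)) / sqrt (2 ^ b i))))" for m
  define c where "c m = \<bar>a (Suc m)\<bar> / real (Suc m) powr (3/2)" for m
  have c0: "0 \<le> c m" for m by (simp add: c_def)
  have L0: "0 \<le> L m" for m unfolding L_def by (rule suminf_nonneg[OF summable_block_bounds]) simp
  show "summable (\<lambda>m. c m * L (Suc m))"
  proof (rule summableI_nonneg_bounded)
    show "0 \<le> c m * L (Suc m)" for m by (rule mult_nonneg_nonneg[OF c0 L0])
  next
    fix M
    let ?u = "\<lambda>m i. c m * (2 ^ Suc i * (2 * (real (min (Suc m) (2 ^ b i)) / sqrt (2 ^ b i))))"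
    have u: "summable (?u m)" for m by (intro summable_mult summable_block_bounds)
    have le: "(\<Sum>m<M. ?u m i) \<le> 4 * (1/2) ^ i" for i
    proof -
      have "(\<Sum>m<M. ?u m i) = 2 ^ Suc i * 2 / sqrt (2 ^ b i)
          * (\<Sum>m<M. \<bar>a (Suc m)\<bar> * (real (min (Suc m) (2 ^ b i)) / real (Suc m) powr (3/2)))"
        unfolding sum_distrib_left c_def by (intro sum.cong refl) (simp add: mult_ac)
      also have "\<dots> \<le> 2 ^ Suc i * 2 / sqrt (2 ^ b i) * ((1/4) ^ i * sqrt (2 ^ b i))"
        by (rule mult_left_mono[OF a]) simp
      also have "\<dots> = 4 * (2 ^ i * (1/4) ^ i)" by simp
      also have "\<dots> = 4 * (1/2) ^ i" by (simp flip: power_mult_distrib)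
      finally show ?thesis .
    qed
    have geo: "(\<lambda>i. 4 * (1/2) ^ i) sums (4 * (1 / (1 - 1/2)) :: real)"
      by (intro sums_mult geometric_sums) simp
    have "(\<Sum>m<M. c m * L (Suc m)) = (\<Sum>m<M. \<Sum>i. ?u m i)"
      unfolding L_def by (rule sum.cong[OF refl suminf_mult[OF summable_block_bounds, symmetric]])
    also have "\<dots> = (\<Sum>i. \<Sum>m<M. ?u m i)" by (rule suminf_sum[symmetric]) (rule u)
    also have "\<dots> \<le> (\<Sum>i. 4 * (1/2) ^ i)"
      by (rule suminf_le[OF le summable_sum[OF u] sums_summable[OF geo]])
    also have "\<dots> = 4 * (1 / (1 - 1/2))" using sums_unique[OF geo] by (rule sym)
    finally show "(\<Sum>m<M. c m * L (Suc m)) \<le> 4 * (1 / (1 - 1/2))" .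
  qed
  fix m
  have "norm (a (Suc m) / real (Suc m) powr (3 / 2) * Lp_norm p noise_space (real_cond_exp noise_space past (ergodic_sum left_shift f (Suc m))))
      = \<bar>a (Suc m)\<bar> / real (Suc m) powr (3 / 2) * Lp_norm p noise_space (real_cond_exp noise_space past (ergodic_sum left_shift f (Suc m)))"
    by (simp add: abs_mult Lp_norm_def)
  also have "\<dots> \<le> c m * L (Suc m)"
    unfolding c_def L_def by (rule mult_left_mono[OF Lp_norm_cond_exp_le]) simp
  finally show "norm (a (Suc m) / real (Suc m) powr (3 / 2) * Lp_norm p noise_space (real_cond_exp noise_space past (ergodic_sum left_shift f (Suc m))))
      \<le> c m * L (Suc m)" .
qed

section \<open>Large increments with probability bounded below\<close>

definition increment :: "nat \<Rightarrow> nat \<Rightarrow> (int \<Rightarrow> nat \<Rightarrow> real) \<Rightarrow> real" where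
  "increment i r \<omega> = (\<Sum>j\<in>{r..<r + 2 ^ b i}. f ((left_shift ^^ j) \<omega>))"

text \<open>The threshold is the total contribution of one level i jump at site r, which enters all
  2 ^ b i values of the increment.\<close>

definition large_increment :: "nat \<Rightarrow> nat \<Rightarrow> (int \<Rightarrow> nat \<Rightarrow> real) set" where
  "large_increment i r = {\<omega>. amp i * 2 ^ b i \<le> \<bar>increment i r \<omega>\<bar>}"

text \<open>Requiring the first jump makes the events for different r disjoint, so that their
  probabilities add up, and keeps them invariant under the flip at r.\<close>

definition first_jump :: "nat \<Rightarrow> nat \<Rightarrow> (int \<Rightarrow> nat \<Rightarrow> real) set" where
  "first_jump i r = {\<omega>. jump (lev i) (\<omega> (int r)) \<noteq> 0 \<and> (\<forall>r'<r. jump (lev i) (\<omega> (int r')) = 0)}"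

text \<open>The range of r ensures that the whole increment lies within the first
  \<open>2 ^ Suc (lev i)\<close> steps.\<close>

definition large_somewhere :: "nat \<Rightarrow> (int \<Rightarrow> nat \<Rightarrow> real) set" where
  "large_somewhere i = (\<Union>r<2 ^ Suc (lev i) - 2 ^ b i. large_increment i r)"

lemma measurable_increment [measurable]: "increment i r \<in> borel_measurable noise_space"
  unfolding increment_def by measurable

lemma large_increment_event [measurable]: "large_increment i r \<in> sets noise_space"
proof -
  have "{\<omega> \<in> space noise_space. amp i * 2 ^ b i \<le> \<bar>increment i r \<omega>\<bar>} \<in> sets noise_space" by measurable
  then show ?thesis by (simp add: large_increment_def)
qed

lemma first_jump_event [measurable]: "first_jump i r \<in> sets noise_space"
proof -
  have "{\<omega> \<in> space noise_space. jump (lev i) (\<omega> (int r)) \<noteq> 0 \<and> (\<forall>r'<r. jump (lev i) (\<omega> (int r')) = 0)} \<in> sets noise_space"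
    by measurable
  then show ?thesis by (simp add: first_jump_def)
qed

lemma large_somewhere_event: "large_somewhere i \<in> sets noise_space"
  unfolding large_somewhere_def by measurable

text \<open>Each of the k times j sees site r exactly once, at position s = j - r.\<close>

lemma double_sum_diagonal:
  fixes x :: real
  shows "(\<Sum>j\<in>{r..<r + k}. \<Sum>s<k. if int j - int s = int r then x else 0) = real k * x"
proof -
  have "(\<Sum>s<k. if int j - int s = int r then x else 0) = x" if "j \<in> {r..<r + k}" for j
  proof -
    have "(\<Sum>s<k. if int j - int s = int r then x else 0) = (\<Sum>s<k. if s = j - r then x else 0)"
      using that by (intro sum.cong refl) auto
    also have "\<dots> = x" using that by (simp add: less_diff_conv2)
    finally show ?thesis .
  qed
  then show ?thesis by simp
qed

text \<open>The number k of times is separate from the block length, since the identity is applied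
  to all levels over the window of one fixed level.\<close>

lemma block_sum_flip_site:
  "(\<Sum>j\<in>{r..<r + k}. block (Suc 0) i ((left_shift ^^ j) \<omega>)) - (\<Sum>j\<in>{r..<r + k}. block (Suc 0) i ((left_shift ^^ j) (flip {int r} \<omega>)))
     = amp i * (\<Sum>j\<in>{r..<r + k}. \<Sum>s<2 ^ b i. if int j - int s = int r then 2 * jump (lev i) (\<omega> (int r)) else 0)"
proof -
  have "(\<Sum>j\<in>{r..<r + k}. block (Suc 0) i ((left_shift ^^ j) \<omega>)) - (\<Sum>j\<in>{r..<r + k}. block (Suc 0) i ((left_shift ^^ j) (flip {int r} \<omega>)))
      = amp i * (\<Sum>j\<in>{r..<r + k}. \<Sum>s<2 ^ b i. jump (lev i) (\<omega> (int j - int s)) - jump (lev i) (flip {int r} \<omega> (int j - int s)))"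
    unfolding block_Suc_0_shift
    by (simp add: sum_subtractf sum_distrib_left right_diff_distrib)
  also have "(\<Sum>j\<in>{r..<r + k}. \<Sum>s<2 ^ b i. jump (lev i) (\<omega> (int j - int s)) - jump (lev i) (flip {int r} \<omega> (int j - int s)))
      = (\<Sum>j\<in>{r..<r + k}. \<Sum>s<2 ^ b i. if int j - int s = int r then 2 * jump (lev i) (\<omega> (int r)) else 0)"
    by (intro sum.cong refl) (auto simp: jump_flip)
  finally show ?thesis .
qed

text \<open>Flipping the sign of the jump at site \<open>r\<close> changes the increment by twice its contribution, so
  at least one of the two configurations has a large increment, whatever the other jumps and
  levels contribute.\<close>

lemma AE_large_increment_or_flip:
  "AE \<omega> in noise_space. \<omega> \<in> first_jump i r \<longrightarrow>
     \<omega> \<in> large_increment i r \<or> flip {int r} \<omega> \<in> large_increment i r"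
  using AE_summable_shifted[of "{}"] AE_summable_shifted[of "{int r}"]
proof eventually_elim
  case (elim \<omega>)
  then have e: "\<forall>j. summable (\<lambda>i. \<bar>block (Suc 0) i ((left_shift ^^ j) \<omega>)\<bar>)" by simp
  show ?case
  proof
    assume "\<omega> \<in> first_jump i r"
    then have J: "jump (lev i) (\<omega> (int r)) \<noteq> 0" by (simp add: first_jump_def)
    let ?A = "{r..<r + 2 ^ b i}"
    note 1 = ergodic_sum_eq_suminf[OF e, of ?A, OF finite_atLeastLessThan]
    note 2 = ergodic_sum_eq_suminf[OF elim(2), of ?A, OF finite_atLeastLessThan]
    have "increment i r \<omega> - increment i r (flip {int r} \<omega>)
        = (\<Sum>i'. (\<Sum>j\<in>?A. block (Suc 0) i' ((left_shift ^^ j) \<omega>)) - (\<Sum>j\<in>?A. block (Suc 0) i' ((left_shift ^^ j) (flip {int r} \<omega>))))"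
      unfolding increment_def 1(2) 2(2) by (rule suminf_diff[OF 1(1) 2(1)])
    also have "\<dots> = (\<Sum>i'. if i' = i then amp i * (2 ^ b i * (2 * jump (lev i) (\<omega> (int r)))) else 0)"
    proof (rule suminf_cong)
      fix i'
      show "(\<Sum>j\<in>?A. block (Suc 0) i' ((left_shift ^^ j) \<omega>)) - (\<Sum>j\<in>?A. block (Suc 0) i' ((left_shift ^^ j) (flip {int r} \<omega>)))
          = (if i' = i then amp i * (2 ^ b i * (2 * jump (lev i) (\<omega> (int r)))) else 0)"
      proof (cases "i' = i")
        case True
        show ?thesis unfolding True block_sum_flip_site
          using double_sum_diagonal[where x = "2 * jump (lev i) (\<omega> (int r))" and r = r and k = "2 ^ b i"] by simp
      next
        case False
        \<comment> \<open>A site carries one level and \<open>lev\<close> is injective, so the flip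
          leaves all other levels unchanged.\<close>
        then have "jump (lev i') (\<omega> (int r)) = 0" using jump_eq_0_if_other[OF J] inj_lev by metis
        then show ?thesis unfolding block_sum_flip_site using False by (simp cong: if_cong)
      qed
    qed
    also have "\<dots> = amp i * (2 ^ b i * (2 * jump (lev i) (\<omega> (int r))))"
      using sums_unique[OF sums_single[of i "\<lambda>_. amp i * (2 ^ b i * (2 * jump (lev i) (\<omega> (int r))))"]] by simp
    finally have "\<bar>increment i r \<omega> - increment i r (flip {int r} \<omega>)\<bar> = 2 * (amp i * 2 ^ b i)"
      using J amp_pos[of i] by (simp add: abs_mult abs_jump)
    then have "amp i * 2 ^ b i \<le> \<bar>increment i r \<omega>\<bar> \<or> amp i * 2 ^ b i \<le> \<bar>increment i r (flip {int r} \<omega>)\<bar>"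
      by linarith
    then show "\<omega> \<in> large_increment i r \<or> flip {int r} \<omega> \<in> large_increment i r"
      by (simp add: large_increment_def)
  qed
qed

lemma flip_first_jump: "flip {int r} \<omega> \<in> first_jump i r \<longleftrightarrow> \<omega> \<in> first_jump i r"
  by (auto simp: first_jump_def jump_flip)

text \<open>Up to a null set, the event is covered by its part with a large increment and the
  preimage of that part under the flip, and these have equal probability.\<close>

lemma prob_first_jump_le:
  "noise.prob (first_jump i r) \<le> 2 * noise.prob (first_jump i r \<inter> large_increment i r)"
proof -
  let ?E = "first_jump i r \<inter> large_increment i r" and ?\<phi> = "flip {int r}"
  have E [measurable]: "?E \<in> sets noise_space" by measurable
  have E': "?\<phi> -` ?E \<in> sets noise_space" using measurable_sets[OF measurable_flip E] by simp
  have "noise.prob (first_jump i r) \<le> noise.prob (?E \<union> ?\<phi> -` ?E)"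
  proof (rule noise.finite_measure_mono_AE)
    show "AE \<omega> in noise_space. \<omega> \<in> first_jump i r \<longrightarrow> \<omega> \<in> ?E \<union> ?\<phi> -` ?E"
      using AE_large_increment_or_flip[of i r] by eventually_elim (auto simp: flip_first_jump)
    show "?E \<union> ?\<phi> -` ?E \<in> sets noise_space" using E E' by (rule sets.Un)
  qed
  also have "\<dots> \<le> noise.prob ?E + noise.prob (?\<phi> -` ?E)"
    by (rule measure_Un_le[OF E E'])
  also have "noise.prob (?\<phi> -` ?E) = measure (distr noise_space noise_space ?\<phi>) ?E"
    using measure_distr[OF measurable_flip E] by simp
  also have "\<dots> = noise.prob ?E" by (simp add: distr_flip)
  finally show ?thesis by simp
qed

lemma prob_no_jump:
  "noise.prob {\<omega>. \<forall>r<R. jump (lev i) (\<omega> (int r)) = 0} = (1 - 1 / 2 ^ Suc (lev i)) ^ R"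
proof -
  have "{\<omega>. \<forall>r<R. jump (lev i) (\<omega> (int r)) = 0}
      = {\<omega>. \<forall>r\<in>int ` {..<R}. \<omega> r \<in> {u. jump (lev i) u = 0}}" by auto
  then have "noise.prob {\<omega>. \<forall>r<R. jump (lev i) (\<omega> (int r)) = 0}
      = measure_pmf.prob noise {u. jump (lev i) u = 0} ^ R"
    using prob_cylinder[of "int ` {..<R}" "\<lambda>_. {u. jump (lev i) u = 0}"] by (simp add: card_image)
  also have "{u. jump (lev i) u = 0} = UNIV - {u. jump (lev i) u \<noteq> 0}" by auto
  also have "measure_pmf.prob noise \<dots> = 1 - measure_pmf.prob noise {u. jump (lev i) u \<noteq> 0}"
    using measure_pmf.prob_compl[of "{u. jump (lev i) u \<noteq> 0}" noise] by simp
  finally show ?thesis by (simp only: prob_jump_nonzero)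
qed

text \<open>Bernoulli's inequality bounds 1 + R x by (1 + x)^R, and (1 - x)^R (1 + x)^R = (1 -
  x^2)^R is at most 1.\<close>

lemma power_one_minus_le:
  fixes x :: real
  assumes "0 \<le> x" "x \<le> 1"
  shows "(1 - x) ^ R \<le> 1 / (1 + real R * x)"
proof -
  have "(1 - x) ^ R * (1 + real R * x) \<le> (1 - x) ^ R * (1 + x) ^ R"
    using assms Bernoulli_inequality[of x R] by (intro mult_left_mono) auto
  also have "\<dots> = (1 - x\<^sup>2) ^ R"
    by (simp add: power_mult_distrib[symmetric] algebra_simps power2_eq_square)
  also have "\<dots> \<le> 1" using assms by (intro power_le_one) (auto simp: power_le_one)
  finally show ?thesis using assms by (simp add: pos_le_divide_eq add_pos_nonneg)
qed

lemma two_block_le_period: "2 * 2 ^ b i \<le> (2 :: nat) ^ Suc (lev i)"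
proof -
  have "b i + 1 \<le> Suc (lev i)"
  proof -
    have "1 \<le> q" using p by linarith
    then have "b i * 2 \<le> b i * Suc q" by (intro mult_le_mono2) simp
    then show ?thesis using b_ge[of i] by (simp add: lev_def)
  qed
  then have "(2 :: nat) ^ (b i + 1) \<le> 2 ^ Suc (lev i)" by (intro power_increasing) auto
  then show ?thesis by simp
qed

text \<open>At least half of the n sites are admissible, so one of them has a jump with probability
  at least 1 - 1 / (1 + 1/2) = 1/3. The flip argument costs a factor 2, whence 1/6 at every
  level.\<close>

lemma prob_large_somewhere: "1 / 6 \<le> noise.prob (large_somewhere i)"
proof -
  define n where "n = (2 :: nat) ^ Suc (lev i)"
  define R where "R = n - 2 ^ b i"
  have "2 * 2 ^ b i \<le> n" unfolding n_def by (rule two_block_le_period)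
  then have "n \<le> 2 * R" unfolding R_def by linarith
  then have R: "real n / 2 \<le> real R" "n > 0" by (auto simp: n_def)
  have disj: "disjoint_family_on (first_jump i) {..<R}"
    unfolding disjoint_family_on_def first_jump_def by (auto dest: linorder_neqE_nat)
  have "(\<Union>r<R. first_jump i r) = UNIV - {\<omega>. \<forall>r<R. jump (lev i) (\<omega> (int r)) = 0}"
  proof (intro set_eqI iffI)
    fix \<omega> assume "\<omega> \<in> UNIV - {\<omega>. \<forall>r<R. jump (lev i) (\<omega> (int r)) = 0}"
    then have ex: "\<exists>r. r < R \<and> jump (lev i) (\<omega> (int r)) \<noteq> 0" by blast
    let ?r = "LEAST r. r < R \<and> jump (lev i) (\<omega> (int r)) \<noteq> 0"
    have r: "?r < R \<and> jump (lev i) (\<omega> (int ?r)) \<noteq> 0" using ex by (rule LeastI_ex)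
    moreover have "jump (lev i) (\<omega> (int r')) = 0" if "r' < ?r" for r'
      using not_less_Least[OF that] that r by auto
    ultimately have "\<omega> \<in> first_jump i ?r" unfolding first_jump_def by blast
    then show "\<omega> \<in> (\<Union>r<R. first_jump i r)" using r by blast
  qed (auto simp: first_jump_def)
  moreover have "{\<omega> \<in> space noise_space. \<forall>r<R. jump (lev i) (\<omega> (int r)) = 0} \<in> sets noise_space" by measurable
  ultimately have "noise.prob (\<Union>r<R. first_jump i r) = 1 - (1 - 1 / real n) ^ R"
    using noise.prob_compl[of "{\<omega>. \<forall>r<R. jump (lev i) (\<omega> (int r)) = 0}"]
    by (simp add: prob_no_jump n_def)
  also have "\<dots> \<ge> 1 - 1 / (1 + real R * (1 / real n))"
    using R by (intro diff_left_mono power_one_minus_le) auto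
  finally have "1 - 1 / (1 + real R * (1 / real n)) \<le> noise.prob (\<Union>r<R. first_jump i r)" .
  moreover have "1 / (1 + real R * (1 / real n)) \<le> 1 / (1 + 1 / 2)"
    using R by (intro divide_left_mono add_left_mono) (auto simp: field_simps intro!: mult_pos_pos add_pos_nonneg)
  ultimately have "1 / 3 \<le> noise.prob (\<Union>r<R. first_jump i r)" by simp
  also have "\<dots> = (\<Sum>r<R. noise.prob (first_jump i r))"
    using disj by (intro noise.finite_measure_finite_Union) auto
  also have "\<dots> \<le> (\<Sum>r<R. 2 * noise.prob (first_jump i r \<inter> large_increment i r))"
    by (intro sum_mono prob_first_jump_le)
  also have "\<dots> = 2 * noise.prob (\<Union>r<R. first_jump i r \<inter> large_increment i r)"
  proof -
    have "disjoint_family_on (\<lambda>r. first_jump i r \<inter> large_increment i r) {..<R}"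
      using disj unfolding disjoint_family_on_def by blast
    then have "noise.prob (\<Union>r<R. first_jump i r \<inter> large_increment i r)
        = (\<Sum>r<R. noise.prob (first_jump i r \<inter> large_increment i r))"
      by (intro noise.finite_measure_finite_Union) auto
    then show ?thesis by (simp add: sum_distrib_left)
  qed
  also have "\<dots> \<le> 2 * noise.prob (large_somewhere i)"
    unfolding large_somewhere_def R_def n_def
    by (intro mult_left_mono noise.finite_measure_mono UN_mono sets.finite_UN) auto
  finally show ?thesis by simp
qed

section \<open>From large increments to the failure of tightness\<close>

lemma normalized_path_grid:
  assumes "j \<le> n" "n > 0"
  shows "normalized_path T h n \<omega> (real j / real n) = real n powr (- 1 / 2) * ergodic_sum T h j \<omega>"
  using assms by (simp add: normalized_path_def partial_sum_path_def)

text \<open>With k = 2 ^ b i and n = 2 ^ Suc (lev i), the grid points r/n and (r + k)/n serve as s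
  and t. There n^(-1/2) amp k equals (k/n)^(1/2 - 1/p), and k/n \<le> 1/k because n = k^(q+1) with q
  \<ge> 1.\<close>

lemma large_quotient:
  assumes "\<omega> \<in> large_somewhere i"
  shows "\<exists>s t. 0 \<le> s \<and> s < t \<and> t \<le> 1 \<and> t - s \<le> 1 / 2 ^ b i \<and>
    1 \<le> \<bar>normalized_path left_shift f (2 ^ Suc (lev i)) \<omega> t - normalized_path left_shift f (2 ^ Suc (lev i)) \<omega> s\<bar>
          / (t - s) powr (1 / 2 - 1 / p)"
proof -
  define n where "n = (2 :: nat) ^ Suc (lev i)"
  define k where "k = (2 :: nat) ^ b i"
  have k0: "k > 0" and n0: "n > 0" by (simp_all add: k_def n_def)
  obtain r where r: "r < n - k" "amp i * real k \<le> \<bar>increment i r \<omega>\<bar>"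
    using assms by (auto simp: large_somewhere_def large_increment_def n_def k_def)
  have rk: "r + k \<le> n" and rn: "r \<le> n" using r(1) by linarith+
  have inc: "ergodic_sum left_shift f (r + k) \<omega> - ergodic_sum left_shift f r \<omega> = increment i r \<omega>"
    unfolding ergodic_sum_def increment_def k_def[symmetric] lessThan_atLeast0
    by (subst sum_diff_nat_ivl) auto
  let ?s = "real r / real n" and ?t = "real (r + k) / real n"
  have ts: "?t - ?s = real k / real n" by (simp add: add_divide_distrib)
  have "k * k \<le> n"
  proof -
    have "1 \<le> q" using p by linarith
    then have "k ^ 2 \<le> k ^ Suc q" using k0 by (intro power_increasing) auto
    then show ?thesis by (simp add: n_def k_def period power2_eq_square del: power_Suc)
  qed
  then have "real (k * k) \<le> real n" by (rule of_nat_mono)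
  then have small: "real k / real n \<le> 1 / real k" using k0 n0 by (simp add: field_simps)
  have "normalized_path left_shift f n \<omega> ?t - normalized_path left_shift f n \<omega> ?s
      = real n powr (- 1 / 2) * increment i r \<omega>"
    unfolding normalized_path_grid[OF rk n0] normalized_path_grid[OF rn n0] inc[symmetric]
    by (simp add: right_diff_distrib)
  then have "\<bar>normalized_path left_shift f n \<omega> ?t - normalized_path left_shift f n \<omega> ?s\<bar>
      = real n powr (- 1 / 2) * \<bar>increment i r \<omega>\<bar>"
    by (simp add: abs_mult)
  also have "\<dots> \<ge> real n powr (- 1 / 2) * (amp i * real k)"
    by (intro mult_left_mono r) simp
  also have "real n powr (- 1 / 2) * (amp i * real k) = (real k / real n) powr (1 / 2 - 1 / p)"
  proof -
    have e: "- 1 / 2 + 1 / p = - (1 / 2 - 1 / p)" "- 1 / 2 - 1 / p + 1 = 1 / 2 - 1 / p" by simp_all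
    have "amp i = real n powr (1 / p) * real k powr (- 1 / 2 - 1 / p)"
      by (simp add: amp_def n_def k_def)
    then have "real n powr (- 1 / 2) * (amp i * real k)
        = (real n powr (- 1 / 2) * real n powr (1 / p)) * (real k powr (- 1 / 2 - 1 / p) * real k powr 1)"
      using k0 by simp
    also have "\<dots> = real n powr (- (1 / 2 - 1 / p)) * real k powr (1 / 2 - 1 / p)"
      unfolding powr_add[symmetric] e ..
    also have "\<dots> = (real k / real n) powr (1 / 2 - 1 / p)"
      by (simp add: powr_divide powr_minus divide_simps)
    finally show ?thesis .
  qed
  finally have "(?t - ?s) powr (1 / 2 - 1 / p)
      \<le> \<bar>normalized_path left_shift f n \<omega> ?t - normalized_path left_shift f n \<omega> ?s\<bar>"
    by (simp only: ts)
  moreover have "0 < (?t - ?s) powr (1 / 2 - 1 / p)" using k0 n0 by (simp only: ts) simp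
  ultimately have "1 \<le> \<bar>normalized_path left_shift f n \<omega> ?t - normalized_path left_shift f n \<omega> ?s\<bar>
      / (?t - ?s) powr (1 / 2 - 1 / p)" by (simp only: pos_le_divide_eq mult_1_left)
  moreover have "0 \<le> ?s" by simp
  moreover have "?s < ?t" using k0 n0 by (intro divide_strict_right_mono) auto
  moreover have "?t \<le> 1" using r n0 by simp
  moreover have "?t - ?s \<le> 1 / 2 ^ b i" unfolding ts using small by (simp add: k_def)
  ultimately show ?thesis unfolding n_def by blast
qed

lemma not_tight: "\<not> tight_in (holder_topology (1 / 2 - 1 / p)) noise_space (normalized_path left_shift f)"
proof (rule noise.not_tight_if_short_large_quotients)
  show "1 / 2 - 1 / p < 1" using p by (simp add: field_simps)
  have "(\<lambda>i. (1 / 2) ^ b i :: real) \<longlonglongrightarrow> 0"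
    using LIMSEQ_subseq_LIMSEQ[OF LIMSEQ_realpow_zero[of "1/2 :: real"] b_mono] by (simp add: o_def)
  then show "(\<lambda>i. 1 / 2 ^ b i :: real) \<longlonglongrightarrow> 0" by (simp add: power_divide)
  show "(0::real) < 1 / 6" by simp
  show "(1 :: nat) \<le> 2 ^ Suc (lev i)" for i by (rule one_le_power) simp
qed (rule measurable_f_shift large_somewhere_event prob_large_somewhere large_quotient, assumption?)+

end

theorem theorem1p5:
  fixes a :: "nat \<Rightarrow> real" and p :: real
  assumes "a \<longlonglongrightarrow> 0" and "p > 2"
  shows "\<exists>(M :: (int \<Rightarrow> nat \<Rightarrow> real) measure) T N f.
           prob_space M \<and>
           invertible_measure_preserving M T \<and>
           subalgebra M N \<and>
           (\<forall>A\<in>sets N. T ` A \<in> sets N) \<and>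
           f \<in> borel_measurable N \<and>
           in_Lp p M f \<and>
           strictly_stationary M (\<lambda>j \<omega>. f ((T ^^ j) \<omega>)) \<and>
           summable (\<lambda>k. a (Suc k) / real (Suc k) powr (3 / 2) *
                         Lp_norm p M (real_cond_exp M N (ergodic_sum T f (Suc k)))) \<and>
           \<not> tight_in (holder_topology (1 / 2 - 1 / p)) M (normalized_path T f)"
proof -
  obtain b where b: "strict_mono b" "\<And>i. 4 * i + 1 \<le> b i"
    and a: "\<And>i M. (\<Sum>m<M. \<bar>a (Suc m)\<bar> * (real (min (Suc m) (2 ^ b i)) / real (Suc m) powr (3/2)))
              \<le> (1/4) ^ i * sqrt (2 ^ b i)"
    using exists_block_exponents[OF assms(1)] by blast
  \<comment> \<open>Rounding p up to an integer keeps the period \<open>(2 ^ b i) ^ Suc q\<close> a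
    power of two, as the frequencies of the levels demand.\<close>
  interpret jump_process p "nat \<lceil>p\<rceil>" b
  proof
    show "p > 2" by (rule assms(2))
    show "p \<le> real (nat \<lceil>p\<rceil>)" by (rule real_nat_ceiling_ge)
  qed (rule b)+
  show ?thesis
  proof (intro exI conjI ballI)
    show "prob_space noise_space" by (rule noise.prob_space_axioms)
    show "invertible_measure_preserving noise_space left_shift" by (rule invertible_shift)
    show "subalgebra noise_space past" by (rule subalgebra_past)
    show "left_shift ` A \<in> sets past" if "A \<in> sets past" for A by (rule shift_past[OF that])
    show "f \<in> borel_measurable past" by (rule measurable_proj_past)
    show "in_Lp p noise_space f" by (rule proj_in_Lp)
    show "strictly_stationary noise_space (\<lambda>j \<omega>. f ((left_shift ^^ j) \<omega>))"
      by (rule strictly_stationary_funpow[OF measurable_shift distr_shift measurable_proj])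
    show "summable (\<lambda>k. a (Suc k) / real (Suc k) powr (3 / 2) *
        Lp_norm p noise_space (real_cond_exp noise_space past (ergodic_sum left_shift f (Suc k))))"
      by (rule summable_cond_exp[OF a])
    show "\<not> tight_in (holder_topology (1 / 2 - 1 / p)) noise_space (normalized_path left_shift f)"
      by (rule not_tight)
  qed
qed

end
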